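(* Let $(\mathfrak g,\cdot,\ast)$ be a compatible pre-Lie algebra over a field $\mathbb K$, let $V$ be a vector space regarded as an abelian compatible pre-Lie algebra, and fix a representation $(V,\rho,\mu,\tilde\rho,\tilde\mu)$ of $(\mathfrak g,\cdot,\ast)$. Then abelian extensions of $(\mathfrak g,\cdot,\ast)$ by $V$ that induce the given representation are classified by $\mathcal H^2(\mathfrak g;V)$; that is, sending an abelian extension $\hat{\mathfrak g}$ to the class of the $2$-cocycle $(\theta,\tilde\theta)$ defined by a section is well defined (independent of the section and of the isomorphism class representative) and gives a bijection from the set of isomorphism classes of such abelian extensions to $\mathcal H^2(\mathfrak g;V)$.
   Context: Pre-Lie algebra: a vector space with a bilinear product $\cdot$ satisfying $(x\cdot y)\cdot z-x\cdot(y\cdot z)=(y\cdot x)\cdot z-y\cdot(x\cdot z)$. Compatible pre-Lie algebra: a triple $(\mathfrak g,\cdot,\ast)$ where $\cdot,\ast$ are pre-Lie products such that $(x\ast y)\cdot z+(x\cdot y)\ast z-x\cdot(y\ast z)-x\ast(y\cdot z)-(y\ast x)\cdot z-(y\cdot x)\ast z+y\cdot(x\ast z)+y\ast(x\cdot z)=0$. Homomorphisms are linear maps preserving both products. It is abelian if both products are zero. Representation of a pre-Lie algebra $(\mathfrak g,\cdot)$ on $V$: linear maps $\rho,\mu:\mathfrak g\to\mathfrak{gl}(V)$ with $\rho(x\cdot y-y\cdot x)=\rho(x)\rho(y)-\rho(y)\rho(x)$ and $\mu(y)\mu(x)-\mu(x\cdot y)=\mu(y)\rho(x)-\rho(x)\mu(y)$.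 Representation of $(\mathfrak g,\cdot,\ast)$: $(V,\rho,\mu,\tilde\rho,\tilde\mu)$ with $(V,\rho,\mu)$ a representation of $(\mathfrak g,\cdot)$, $(V,\tilde\rho,\tilde\mu)$ a representation of $(\mathfrak g,\ast)$, and for all $x,y$: $\rho(x\ast y)+\tilde\rho(x\cdot y)-\rho(x)\tilde\rho(y)-\tilde\rho(x)\rho(y)=\rho(y\ast x)+\tilde\rho(y\cdot x)-\rho(y)\tilde\rho(x)-\tilde\rho(y)\rho(x)$ and $\mu(y)\tilde\rho(x)-\rho(x)\tilde\mu(y)-\mu(y)\tilde\mu(x)+\mu(x\ast y)=-\tilde\mu(y)\rho(x)+\tilde\rho(x)\mu(y)+\tilde\mu(y)\mu(x)-\tilde\mu(x\cdot y)$. Second cohomology: write $\pi_1=\cdot$, $\pi_2=\ast$. For $(\pi,r,m)\in\{(\pi_1,\rho,\mu),(\pi_2,\tilde\rho,\tilde\mu)\}$, $f\in\mathrm{Hom}(\mathfrak g,V)$, $\omega\in\mathrm{Hom}(\otimes^2\mathfrak g,V)$ put $(\partial_{\pi+r+m}f)(x,y)=r(x)f(y)+m(y)f(x)-f(\pi(x,y))$ and $(\partial_{\pi+r+m}\omega)(x,y,z)=r(x)\omega(y,z)-r(y)\omega(x,z)+m(z)\omega(y,x)-m(z)\omega(x,y)-\omega(y,\pi(x,z))+\omega(x,\pi(y,z))-\omega(\pi(x,y)-\pi(y,x),z)$. A $2$-cocycle is a pair $(\omega_1,\omega_2)$ in $\mathrm{Hom}(\otimes^2\mathfrak g,V)^2$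 with $\partial_{\pi_1+\rho+\mu}\omega_1=0$, $\partial_{\pi_2+\tilde\rho+\tilde\mu}\omega_1+\partial_{\pi_1+\rho+\mu}\omega_2=0$, $\partial_{\pi_2+\tilde\rho+\tilde\mu}\omega_2=0$; a $2$-coboundary is a pair $(\partial_{\pi_1+\rho+\mu}f,\partial_{\pi_2+\tilde\rho+\tilde\mu}f)$; $\mathcal H^2(\mathfrak g;V)$ is the quotient. An abelian extension of $(\mathfrak g,\cdot,\ast)$ by $V$ is a short exact sequence of compatible pre-Lie algebra homomorphisms $0\to V\to\hat{\mathfrak g}\xrightarrow{p}\mathfrak g\to0$ with $V$ abelian ($V$ is identified with its image). A section is a linear map $s:\mathfrak g\to\hat{\mathfrak g}$ with $p\circ s=\mathrm{Id}_{\mathfrak g}$. The induced representation is $\rho(x)u=s(x)\cdot_{\hat{\mathfrak g}}u$, $\mu(x)u=u\cdot_{\hat{\mathfrak g}}s(x)$, $\tilde\rho(x)u=s(x)\ast_{\hat{\mathfrak g}}u$, $\tilde\mu(x)u=u\ast_{\hat{\mathfrak g}}s(x)$ (independent of $s$), and the cocycle is $\theta(x,y)=s(x)\cdot_{\hat{\mathfrak g}}s(y)-s(x\cdot y)$, $\tilde\theta(x,y)=s(x)\ast_{\hat{\mathfrak g}}s(y)-s(x\ast y)$. Two abelian extensions $\hat{\mathfrak g}_1,\hat{\mathfrak g}_2$ are isomorphic if there is a compatible pre-Lie algebra isomorphism $\zeta:\hat{\mathfrak g}_1\to\hat{\mathfrak g}_2$ restricting to the identity on $V$ and with $p_2\circ\zeta=p_1$.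 *)

theory Defs
  imports "Jordan_Normal_Form.Missing_VectorSpace"
begin

section \<open>Linear and bilinear maps\<close>

text \<open>Vector spaces over \<open>K\<close> are given by \<^term>\<open>vectorspace K V\<close>; linear maps \<open>M \<rightarrow> N\<close> are the elements of
  \<^term>\<open>module_hom K M N\<close>.  As for every carrier-based structure, their values outside the carriers
  carry no meaning.\<close>

definition bilinear_maps ::
  "('k, 'r) ring_scheme \<Rightarrow> ('k, 'a, 'x) module_scheme \<Rightarrow> ('k, 'b, 'y) module_scheme
    \<Rightarrow> ('k, 'c, 'z) module_scheme \<Rightarrow> ('a \<Rightarrow> 'b \<Rightarrow> 'c) set" where
  "bilinear_maps K M N P =
     {b. (\<forall>x\<in>carrier M. b x \<in> module_hom K N P) \<and>
         (\<forall>y\<in>carrier N. (\<lambda>x. b x y) \<in> module_hom K M P)}"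


section \<open>Compatible pre-Lie algebras\<close>

text \<open>The fields \<open>mult\<close> and \<open>one\<close> inherited from the ring record through the module record play no role
  (as for modules in the library); the two pre-Lie products are new fields.\<close>

record ('k, 'a) compat_pre_lie = "('k, 'a) module" +
  pdot :: "'a \<Rightarrow> 'a \<Rightarrow> 'a"  (infixl \<open>\<bullet>\<index>\<close> 70)
  past :: "'a \<Rightarrow> 'a \<Rightarrow> 'a"  (infixl \<open>\<star>\<index>\<close> 70)

definition pre_lie_algebra ::
  "('k, 'r) ring_scheme \<Rightarrow> ('k, 'a, 'x) module_scheme \<Rightarrow> ('a \<Rightarrow> 'a \<Rightarrow> 'a) \<Rightarrow> bool" where
  "pre_lie_algebra K G \<pi> \<longleftrightarrow>
     vectorspace K G \<and> \<pi> \<in> bilinear_maps K G G G \<and>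
     (\<forall>x\<in>carrier G. \<forall>y\<in>carrier G. \<forall>z\<in>carrier G.
        \<pi> (\<pi> x y) z \<ominus>\<^bsub>G\<^esub> \<pi> x (\<pi> y z) = \<pi> (\<pi> y x) z \<ominus>\<^bsub>G\<^esub> \<pi> y (\<pi> x z))"

definition compatible_pre_lie_algebra ::
  "('k, 'r) ring_scheme \<Rightarrow> ('k, 'a) compat_pre_lie \<Rightarrow> bool" where
  "compatible_pre_lie_algebra K G \<longleftrightarrow>
     pre_lie_algebra K G (pdot G) \<and> pre_lie_algebra K G (past G) \<and>
     (\<forall>x\<in>carrier G. \<forall>y\<in>carrier G. \<forall>z\<in>carrier G.
        (x \<star>\<^bsub>G\<^esub> y) \<bullet>\<^bsub>G\<^esub> z \<oplus>\<^bsub>G\<^esub> (x \<bullet>\<^bsub>G\<^esub> y) \<star>\<^bsub>G\<^esub> z \<ominus>\<^bsub>G\<^esub> x \<bullet>\<^bsub>G\<^esub> (y \<star>\<^bsub>G\<^esub> z) \<ominus>\<^bsub>G\<^esub> x \<star>\<^bsub>G\<^esub> (y \<bullet>\<^bsub>G\<^esub> z)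
        \<ominus>\<^bsub>G\<^esub> (y \<star>\<^bsub>G\<^esub> x) \<bullet>\<^bsub>G\<^esub> z \<ominus>\<^bsub>G\<^esub> (y \<bullet>\<^bsub>G\<^esub> x) \<star>\<^bsub>G\<^esub> z \<oplus>\<^bsub>G\<^esub> y \<bullet>\<^bsub>G\<^esub> (x \<star>\<^bsub>G\<^esub> z) \<oplus>\<^bsub>G\<^esub> y \<star>\<^bsub>G\<^esub> (x \<bullet>\<^bsub>G\<^esub> z)
        = \<zero>\<^bsub>G\<^esub>)"

definition abelian_compatible_pre_lie_algebra ::
  "('k, 'r) ring_scheme \<Rightarrow> ('k, 'a) compat_pre_lie \<Rightarrow> bool" where
  "abelian_compatible_pre_lie_algebra K V \<longleftrightarrow>
     compatible_pre_lie_algebra K V \<and>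
     (\<forall>x\<in>carrier V. \<forall>y\<in>carrier V. x \<bullet>\<^bsub>V\<^esub> y = \<zero>\<^bsub>V\<^esub> \<and> x \<star>\<^bsub>V\<^esub> y = \<zero>\<^bsub>V\<^esub>)"

definition compat_pre_lie_hom ::
  "('k, 'r) ring_scheme \<Rightarrow> ('k, 'a) compat_pre_lie \<Rightarrow> ('k, 'b) compat_pre_lie \<Rightarrow> ('a \<Rightarrow> 'b) set" where
  "compat_pre_lie_hom K G H =
     {f \<in> module_hom K G H. \<forall>x\<in>carrier G. \<forall>y\<in>carrier G.
        f (x \<bullet>\<^bsub>G\<^esub> y) = f x \<bullet>\<^bsub>H\<^esub> f y \<and> f (x \<star>\<^bsub>G\<^esub> y) = f x \<star>\<^bsub>H\<^esub> f y}"


section \<open>Representations\<close>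

text \<open>A linear map \<open>\<rho> : G \<rightarrow> gl(V)\<close> is given as the bilinear map \<open>(x, u) \<mapsto> \<rho> x u\<close>, and identities in \<open>gl(V)\<close>
  are stated pointwise on \<open>V\<close>.\<close>

definition pre_lie_representation ::
  "('k, 'r) ring_scheme \<Rightarrow> ('k, 'g, 'x) module_scheme \<Rightarrow> ('g \<Rightarrow> 'g \<Rightarrow> 'g) \<Rightarrow> ('k, 'v, 'y) module_scheme
    \<Rightarrow> ('g \<Rightarrow> 'v \<Rightarrow> 'v) \<Rightarrow> ('g \<Rightarrow> 'v \<Rightarrow> 'v) \<Rightarrow> bool" where
  "pre_lie_representation K G \<pi> V r m \<longleftrightarrow>
     r \<in> bilinear_maps K G V V \<and> m \<in> bilinear_maps K G V V \<and>
     (\<forall>x\<in>carrier G. \<forall>y\<in>carrier G. \<forall>u\<in>carrier V.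
        r (\<pi> x y \<ominus>\<^bsub>G\<^esub> \<pi> y x) u = r x (r y u) \<ominus>\<^bsub>V\<^esub> r y (r x u) \<and>
        m y (m x u) \<ominus>\<^bsub>V\<^esub> m (\<pi> x y) u = m y (r x u) \<ominus>\<^bsub>V\<^esub> r x (m y u))"

definition compat_representation ::
  "('k, 'r) ring_scheme \<Rightarrow> ('k, 'g) compat_pre_lie \<Rightarrow> ('k, 'v, 'y) module_scheme
    \<Rightarrow> ('g \<Rightarrow> 'v \<Rightarrow> 'v) \<Rightarrow> ('g \<Rightarrow> 'v \<Rightarrow> 'v) \<Rightarrow> ('g \<Rightarrow> 'v \<Rightarrow> 'v) \<Rightarrow> ('g \<Rightarrow> 'v \<Rightarrow> 'v) \<Rightarrow> bool" where
  "compat_representation K G V \<rho> \<mu> \<rho>' \<mu>' \<longleftrightarrow>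
     vectorspace K V \<and>
     pre_lie_representation K G (pdot G) V \<rho> \<mu> \<and> pre_lie_representation K G (past G) V \<rho>' \<mu>' \<and>
     (\<forall>x\<in>carrier G. \<forall>y\<in>carrier G. \<forall>u\<in>carrier V.
        \<rho> (x \<star>\<^bsub>G\<^esub> y) u \<oplus>\<^bsub>V\<^esub> \<rho>' (x \<bullet>\<^bsub>G\<^esub> y) u \<ominus>\<^bsub>V\<^esub> \<rho> x (\<rho>' y u) \<ominus>\<^bsub>V\<^esub> \<rho>' x (\<rho> y u)
        = \<rho> (y \<star>\<^bsub>G\<^esub> x) u \<oplus>\<^bsub>V\<^esub> \<rho>' (y \<bullet>\<^bsub>G\<^esub> x) u \<ominus>\<^bsub>V\<^esub> \<rho> y (\<rho>' x u) \<ominus>\<^bsub>V\<^esub> \<rho>' y (\<rho> x u) \<and>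
        \<mu> y (\<rho>' x u) \<ominus>\<^bsub>V\<^esub> \<rho> x (\<mu>' y u) \<ominus>\<^bsub>V\<^esub> \<mu> y (\<mu>' x u) \<oplus>\<^bsub>V\<^esub> \<mu> (x \<star>\<^bsub>G\<^esub> y) u
        = \<ominus>\<^bsub>V\<^esub> \<mu>' y (\<rho> x u) \<oplus>\<^bsub>V\<^esub> \<rho>' x (\<mu> y u) \<oplus>\<^bsub>V\<^esub> \<mu>' y (\<mu> x u) \<ominus>\<^bsub>V\<^esub> \<mu>' (x \<bullet>\<^bsub>G\<^esub> y) u)"


section \<open>Second cohomology\<close>

text \<open>\<open>Hom(G, V)\<close> and \<open>Hom(\<otimes>\<^sup>2 G, V)\<close>.  Cochains are made extensional (\<^term>\<open>undefined\<close> outside the carrier),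
  so that two cochains are equal iff they agree on the carrier of \<open>G\<close>.\<close>

definition cochains1 ::
  "('k, 'r) ring_scheme \<Rightarrow> ('k, 'g, 'x) module_scheme \<Rightarrow> ('k, 'v, 'y) module_scheme \<Rightarrow> ('g \<Rightarrow> 'v) set" where
  "cochains1 K G V = module_hom K G V \<inter> extensional (carrier G)"

definition cochains2 ::
  "('k, 'r) ring_scheme \<Rightarrow> ('k, 'g, 'x) module_scheme \<Rightarrow> ('k, 'v, 'y) module_scheme
    \<Rightarrow> ('g \<Rightarrow> 'g \<Rightarrow> 'v) set" where
  "cochains2 K G V =
     bilinear_maps K G G V \<inter> (carrier G \<rightarrow>\<^sub>E extensional (carrier G))"

definition cobd1 ::
  "('k, 'g, 'x) module_scheme \<Rightarrow> ('g \<Rightarrow> 'g \<Rightarrow> 'g) \<Rightarrow> ('k, 'v, 'y) module_scheme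
    \<Rightarrow> ('g \<Rightarrow> 'v \<Rightarrow> 'v) \<Rightarrow> ('g \<Rightarrow> 'v \<Rightarrow> 'v) \<Rightarrow> ('g \<Rightarrow> 'v) \<Rightarrow> 'g \<Rightarrow> 'g \<Rightarrow> 'v" where
  "cobd1 G \<pi> V r m f =
     (\<lambda>x\<in>carrier G. \<lambda>y\<in>carrier G. r x (f y) \<oplus>\<^bsub>V\<^esub> m y (f x) \<ominus>\<^bsub>V\<^esub> f (\<pi> x y))"

definition cobd2 ::
  "('k, 'g, 'x) module_scheme \<Rightarrow> ('g \<Rightarrow> 'g \<Rightarrow> 'g) \<Rightarrow> ('k, 'v, 'y) module_scheme
    \<Rightarrow> ('g \<Rightarrow> 'v \<Rightarrow> 'v) \<Rightarrow> ('g \<Rightarrow> 'v \<Rightarrow> 'v) \<Rightarrow> ('g \<Rightarrow> 'g \<Rightarrow> 'v) \<Rightarrow> 'g \<Rightarrow> 'g \<Rightarrow> 'g \<Rightarrow> 'v" where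
  "cobd2 G \<pi> V r m \<omega> x y z =
     r x (\<omega> y z) \<ominus>\<^bsub>V\<^esub> r y (\<omega> x z) \<oplus>\<^bsub>V\<^esub> m z (\<omega> y x) \<ominus>\<^bsub>V\<^esub> m z (\<omega> x y)
     \<ominus>\<^bsub>V\<^esub> \<omega> y (\<pi> x z) \<oplus>\<^bsub>V\<^esub> \<omega> x (\<pi> y z) \<ominus>\<^bsub>V\<^esub> \<omega> (\<pi> x y \<ominus>\<^bsub>G\<^esub> \<pi> y x) z"

definition cocycles2 ::
  "('k, 'r) ring_scheme \<Rightarrow> ('k, 'g) compat_pre_lie \<Rightarrow> ('k, 'v, 'y) module_scheme
    \<Rightarrow> ('g \<Rightarrow> 'v \<Rightarrow> 'v) \<Rightarrow> ('g \<Rightarrow> 'v \<Rightarrow> 'v) \<Rightarrow> ('g \<Rightarrow> 'v \<Rightarrow> 'v) \<Rightarrow> ('g \<Rightarrow> 'v \<Rightarrow> 'v)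
    \<Rightarrow> (('g \<Rightarrow> 'g \<Rightarrow> 'v) \<times> ('g \<Rightarrow> 'g \<Rightarrow> 'v)) set" where
  "cocycles2 K G V \<rho> \<mu> \<rho>' \<mu>' =
     {(\<omega>1, \<omega>2). \<omega>1 \<in> cochains2 K G V \<and> \<omega>2 \<in> cochains2 K G V \<and>
        (\<forall>x\<in>carrier G. \<forall>y\<in>carrier G. \<forall>z\<in>carrier G.
           cobd2 G (pdot G) V \<rho> \<mu> \<omega>1 x y z = \<zero>\<^bsub>V\<^esub> \<and>
           cobd2 G (past G) V \<rho>' \<mu>' \<omega>1 x y z \<oplus>\<^bsub>V\<^esub> cobd2 G (pdot G) V \<rho> \<mu> \<omega>2 x y z = \<zero>\<^bsub>V\<^esub> \<and>
           cobd2 G (past G) V \<rho>' \<mu>' \<omega>2 x y z = \<zero>\<^bsub>V\<^esub>)}"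

definition coboundaries2 ::
  "('k, 'r) ring_scheme \<Rightarrow> ('k, 'g) compat_pre_lie \<Rightarrow> ('k, 'v, 'y) module_scheme
    \<Rightarrow> ('g \<Rightarrow> 'v \<Rightarrow> 'v) \<Rightarrow> ('g \<Rightarrow> 'v \<Rightarrow> 'v) \<Rightarrow> ('g \<Rightarrow> 'v \<Rightarrow> 'v) \<Rightarrow> ('g \<Rightarrow> 'v \<Rightarrow> 'v)
    \<Rightarrow> (('g \<Rightarrow> 'g \<Rightarrow> 'v) \<times> ('g \<Rightarrow> 'g \<Rightarrow> 'v)) set" where
  "coboundaries2 K G V \<rho> \<mu> \<rho>' \<mu>' =
     (\<lambda>f. (cobd1 G (pdot G) V \<rho> \<mu> f, cobd1 G (past G) V \<rho>' \<mu>' f)) ` cochains1 K G V"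

definition cochain_diff ::
  "('k, 'g, 'x) module_scheme \<Rightarrow> ('k, 'v, 'y) module_scheme
    \<Rightarrow> ('g \<Rightarrow> 'g \<Rightarrow> 'v) \<Rightarrow> ('g \<Rightarrow> 'g \<Rightarrow> 'v) \<Rightarrow> 'g \<Rightarrow> 'g \<Rightarrow> 'v" where
  "cochain_diff G V \<omega> \<eta> = (\<lambda>x\<in>carrier G. \<lambda>y\<in>carrier G. \<omega> x y \<ominus>\<^bsub>V\<^esub> \<eta> x y)"

definition cohomologous ::
  "('k, 'r) ring_scheme \<Rightarrow> ('k, 'g) compat_pre_lie \<Rightarrow> ('k, 'v, 'y) module_scheme
    \<Rightarrow> ('g \<Rightarrow> 'v \<Rightarrow> 'v) \<Rightarrow> ('g \<Rightarrow> 'v \<Rightarrow> 'v) \<Rightarrow> ('g \<Rightarrow> 'v \<Rightarrow> 'v) \<Rightarrow> ('g \<Rightarrow> 'v \<Rightarrow> 'v)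
    \<Rightarrow> (('g \<Rightarrow> 'g \<Rightarrow> 'v) \<times> ('g \<Rightarrow> 'g \<Rightarrow> 'v)) rel" where
  "cohomologous K G V \<rho> \<mu> \<rho>' \<mu>' =
     {((\<omega>1, \<omega>2), (\<eta>1, \<eta>2)).
        (\<omega>1, \<omega>2) \<in> cocycles2 K G V \<rho> \<mu> \<rho>' \<mu>' \<and> (\<eta>1, \<eta>2) \<in> cocycles2 K G V \<rho> \<mu> \<rho>' \<mu>' \<and>
        (cochain_diff G V \<omega>1 \<eta>1, cochain_diff G V \<omega>2 \<eta>2) \<in> coboundaries2 K G V \<rho> \<mu> \<rho>' \<mu>'}"

definition cohomology2 ::
  "('k, 'r) ring_scheme \<Rightarrow> ('k, 'g) compat_pre_lie \<Rightarrow> ('k, 'v, 'y) module_scheme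
    \<Rightarrow> ('g \<Rightarrow> 'v \<Rightarrow> 'v) \<Rightarrow> ('g \<Rightarrow> 'v \<Rightarrow> 'v) \<Rightarrow> ('g \<Rightarrow> 'v \<Rightarrow> 'v) \<Rightarrow> ('g \<Rightarrow> 'v \<Rightarrow> 'v)
    \<Rightarrow> (('g \<Rightarrow> 'g \<Rightarrow> 'v) \<times> ('g \<Rightarrow> 'g \<Rightarrow> 'v)) set set" where
  "cohomology2 K G V \<rho> \<mu> \<rho>' \<mu>' = cocycles2 K G V \<rho> \<mu> \<rho>' \<mu>' // cohomologous K G V \<rho> \<mu> \<rho>' \<mu>'"


section \<open>Abelian extensions\<close>

text \<open>An extension \<open>0 \<rightarrow> V \<rightarrow> E \<rightarrow> G \<rightarrow> 0\<close> is the triple of \<open>E\<close>, the embedding \<open>i : V \<rightarrow> E\<close> and \<open>p : E \<rightarrow> G\<close>.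
  The type \<open>'e\<close> is the universe of underlying sets of extensions: isomorphism classes are formed among all
  structures whose carrier is a subset of \<open>'e\<close>.  The carrier of any extension is in bijection with
  \<open>carrier G \<times> carrier V\<close>, so every isomorphism class is represented as soon as \<open>'e\<close> contains a copy
  of that set; two extensions over different types can be compared in their sum type.\<close>

type_synonym ('k, 'g, 'v, 'e) extn = "('k, 'e) compat_pre_lie \<times> ('v \<Rightarrow> 'e) \<times> ('e \<Rightarrow> 'g)"

definition abelian_extension ::
  "('k, 'r) ring_scheme \<Rightarrow> ('k, 'g) compat_pre_lie \<Rightarrow> ('k, 'v) compat_pre_lie
    \<Rightarrow> ('k, 'e) compat_pre_lie \<Rightarrow> ('v \<Rightarrow> 'e) \<Rightarrow> ('e \<Rightarrow> 'g) \<Rightarrow> bool" where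
  "abelian_extension K G V E i p \<longleftrightarrow>
     abelian_compatible_pre_lie_algebra K V \<and>
     compatible_pre_lie_algebra K E \<and>
     i \<in> compat_pre_lie_hom K V E \<and> p \<in> compat_pre_lie_hom K E G \<and>
     inj_on i (carrier V) \<and>
     i ` carrier V = {e \<in> carrier E. p e = \<zero>\<^bsub>G\<^esub>} \<and>
     p ` carrier E = carrier G"

definition linear_section ::
  "('k, 'r) ring_scheme \<Rightarrow> ('k, 'g) compat_pre_lie \<Rightarrow> ('k, 'e) compat_pre_lie
    \<Rightarrow> ('e \<Rightarrow> 'g) \<Rightarrow> ('g \<Rightarrow> 'e) \<Rightarrow> bool" where
  "linear_section K G E p s \<longleftrightarrow> s \<in> module_hom K G E \<and> (\<forall>x\<in>carrier G. p (s x) = x)"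

text \<open>The identification of the image of \<open>i\<close> with \<open>V\<close>.\<close>

abbreviation from_image :: "('k, 'v) compat_pre_lie \<Rightarrow> ('v \<Rightarrow> 'e) \<Rightarrow> 'e \<Rightarrow> 'v" where
  "from_image V i \<equiv> inv_into (carrier V) i"

text \<open>The induced representation does not depend on the section \<open>s\<close>, so one may quantify over all of them.\<close>

definition induces_representation ::
  "('k, 'r) ring_scheme \<Rightarrow> ('k, 'g) compat_pre_lie \<Rightarrow> ('k, 'v) compat_pre_lie
    \<Rightarrow> ('k, 'e) compat_pre_lie \<Rightarrow> ('v \<Rightarrow> 'e) \<Rightarrow> ('e \<Rightarrow> 'g)
    \<Rightarrow> ('g \<Rightarrow> 'v \<Rightarrow> 'v) \<Rightarrow> ('g \<Rightarrow> 'v \<Rightarrow> 'v) \<Rightarrow> ('g \<Rightarrow> 'v \<Rightarrow> 'v) \<Rightarrow> ('g \<Rightarrow> 'v \<Rightarrow> 'v) \<Rightarrow> bool" where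
  "induces_representation K G V E i p \<rho> \<mu> \<rho>' \<mu>' \<longleftrightarrow>
     (\<forall>s. linear_section K G E p s \<longrightarrow>
        (\<forall>x\<in>carrier G. \<forall>u\<in>carrier V.
           \<rho> x u = from_image V i (s x \<bullet>\<^bsub>E\<^esub> i u) \<and>
           \<mu> x u = from_image V i (i u \<bullet>\<^bsub>E\<^esub> s x) \<and>
           \<rho>' x u = from_image V i (s x \<star>\<^bsub>E\<^esub> i u) \<and>
           \<mu>' x u = from_image V i (i u \<star>\<^bsub>E\<^esub> s x)))"

definition extension_cocycle ::
  "('k, 'g) compat_pre_lie \<Rightarrow> ('k, 'v) compat_pre_lie \<Rightarrow> ('k, 'g, 'v, 'e) extn \<Rightarrow> ('g \<Rightarrow> 'e)
    \<Rightarrow> ('g \<Rightarrow> 'g \<Rightarrow> 'v) \<times> ('g \<Rightarrow> 'g \<Rightarrow> 'v)" where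
  "extension_cocycle G V = (\<lambda>(E, i, p) s.
     ((\<lambda>x\<in>carrier G. \<lambda>y\<in>carrier G. from_image V i (s x \<bullet>\<^bsub>E\<^esub> s y \<ominus>\<^bsub>E\<^esub> s (x \<bullet>\<^bsub>G\<^esub> y))),
      (\<lambda>x\<in>carrier G. \<lambda>y\<in>carrier G. from_image V i (s x \<star>\<^bsub>E\<^esub> s y \<ominus>\<^bsub>E\<^esub> s (x \<star>\<^bsub>G\<^esub> y)))))"

definition extensions_inducing ::
  "('k, 'r) ring_scheme \<Rightarrow> ('k, 'g) compat_pre_lie \<Rightarrow> ('k, 'v) compat_pre_lie
    \<Rightarrow> ('g \<Rightarrow> 'v \<Rightarrow> 'v) \<Rightarrow> ('g \<Rightarrow> 'v \<Rightarrow> 'v) \<Rightarrow> ('g \<Rightarrow> 'v \<Rightarrow> 'v) \<Rightarrow> ('g \<Rightarrow> 'v \<Rightarrow> 'v)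
    \<Rightarrow> ('k, 'g, 'v, 'e) extn set" where
  "extensions_inducing K G V \<rho> \<mu> \<rho>' \<mu>' =
     {(E, i, p). abelian_extension K G V E i p \<and> induces_representation K G V E i p \<rho> \<mu> \<rho>' \<mu>'}"

definition extension_iso ::
  "('k, 'r) ring_scheme \<Rightarrow> ('k, 'g) compat_pre_lie \<Rightarrow> ('k, 'v) compat_pre_lie
    \<Rightarrow> ('g \<Rightarrow> 'v \<Rightarrow> 'v) \<Rightarrow> ('g \<Rightarrow> 'v \<Rightarrow> 'v) \<Rightarrow> ('g \<Rightarrow> 'v \<Rightarrow> 'v) \<Rightarrow> ('g \<Rightarrow> 'v \<Rightarrow> 'v)
    \<Rightarrow> ('k, 'g, 'v, 'e) extn rel" where
  "extension_iso K G V \<rho> \<mu> \<rho>' \<mu>' =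
     {((E1, i1, p1), (E2, i2, p2)).
        (E1, i1, p1) \<in> extensions_inducing K G V \<rho> \<mu> \<rho>' \<mu>' \<and>
        (E2, i2, p2) \<in> extensions_inducing K G V \<rho> \<mu> \<rho>' \<mu>' \<and>
        (\<exists>\<zeta>. \<zeta> \<in> compat_pre_lie_hom K E1 E2 \<and> bij_betw \<zeta> (carrier E1) (carrier E2) \<and>
             (\<forall>u\<in>carrier V. \<zeta> (i1 u) = i2 u) \<and> (\<forall>e\<in>carrier E1. p2 (\<zeta> e) = p1 e))}"

end

theory Submission
  imports Defs
begin

text \<open>A linear section \<open>s\<close> identifies an extension \<open>E\<close> with \<open>G \<times> V\<close> through \<open>(x, u) \<mapsto> s x + i u\<close>; under this
  identification both products of \<open>E\<close> become products twisted by the representation and by the cochains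
  \<open>\<theta>\<close> of the section.  For two products \<open>\<pi>\<close>, \<open>\<sigma>\<close> put
  \<open>D\<^sub>\<pi>\<^sub>\<sigma>(x, y, z) = \<pi>(\<sigma>(x, y), z) - \<pi>(x, \<sigma>(y, z)) - (x \<leftrightarrow> y)\<close>.  The axioms of a compatible pre-Lie algebra are
  \<open>D\<^sub>\<pi>\<^sub>\<pi> = 0\<close>, \<open>D\<^sub>\<sigma>\<^sub>\<sigma> = 0\<close> and \<open>D\<^sub>\<pi>\<^sub>\<sigma> + D\<^sub>\<sigma>\<^sub>\<pi> = 0\<close>, and for twisted products the action terms in these expressions
  cancel by the representation axioms, leaving exactly the cocycle conditions.  An isomorphism of extensions
  is in coordinates a shear \<open>(x, u) \<mapsto> (x, u + f x)\<close> with \<open>f\<close> linear, which changes the cocycle by the coboundary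
  of \<open>f\<close>.  Hence extensions are isomorphic iff their cocycles are cohomologous.\<close>

section \<open>Linear algebra\<close>

text \<open>The expression \<open>D\<close> is linear in each of its two products, so the three
  axioms are the coefficients of \<open>D = 0\<close> for the product \<pi> + t \<sigma> with t a
  formal parameter. The condition linking the two components of a cocycle has the same origin: it is
  the coefficient of t in a single cocycle equation. Hence no multi-term identity has to be expanded
  inside an extension: one computation with two independent sets of twisting data, instantiated four
  times, yields all of them. Two points need care. A linear section must exist in arbitrary
  dimension, which calls for Zorn's lemma. Extensions live on subsets of a fixed type
  \<open>'e\<close>, so the model on pairs has to be copied into \<open>'e\<close> along an
  injection. Sections stay arbitrary in the comparison of two extensions. Comparing an extension
  with itself through two sections then gives independence of the section, and isomorphism of
  extensions is the pullback of the cohomology relation, so bijectivity on classes becomes a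
  statement about quotients.\<close>

lemma bilinear_mapsI:
  assumes "\<And>x y. x \<in> carrier M \<Longrightarrow> y \<in> carrier N \<Longrightarrow> b x y \<in> carrier P"
    and "\<And>x x' y. x \<in> carrier M \<Longrightarrow> x' \<in> carrier M \<Longrightarrow> y \<in> carrier N
      \<Longrightarrow> b (x \<oplus>\<^bsub>M\<^esub> x') y = b x y \<oplus>\<^bsub>P\<^esub> b x' y"
    and "\<And>x y y'. x \<in> carrier M \<Longrightarrow> y \<in> carrier N \<Longrightarrow> y' \<in> carrier N
      \<Longrightarrow> b x (y \<oplus>\<^bsub>N\<^esub> y') = b x y \<oplus>\<^bsub>P\<^esub> b x y'"
    and "\<And>c x y. c \<in> carrier K \<Longrightarrow> x \<in> carrier M \<Longrightarrow> y \<in> carrier N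
      \<Longrightarrow> b (c \<odot>\<^bsub>M\<^esub> x) y = c \<odot>\<^bsub>P\<^esub> b x y"
    and "\<And>c x y. c \<in> carrier K \<Longrightarrow> x \<in> carrier M \<Longrightarrow> y \<in> carrier N
      \<Longrightarrow> b x (c \<odot>\<^bsub>N\<^esub> y) = c \<odot>\<^bsub>P\<^esub> b x y"
  shows "b \<in> bilinear_maps K M N P"
  using assms by (auto simp: bilinear_maps_def module_hom_def)

lemma bilinear_maps_hom_left:
  "b \<in> bilinear_maps K M N P \<Longrightarrow> y \<in> carrier N \<Longrightarrow> (\<lambda>x. b x y) \<in> module_hom K M P"
  by (simp add: bilinear_maps_def)

lemma bilinear_maps_hom_right:
  "b \<in> bilinear_maps K M N P \<Longrightarrow> x \<in> carrier M \<Longrightarrow> b x \<in> module_hom K N P"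
  by (simp add: bilinear_maps_def)

locale bilinear_map =
  M: module K M + N: module K N + P: module K P for K M N P +
  fixes b
  assumes bilinear: "b \<in> bilinear_maps K M N P"
begin

lemma hom_left: "y \<in> carrier N \<Longrightarrow> mod_hom K M P (\<lambda>x. b x y)"
  by unfold_locales (rule bilinear_maps_hom_left[OF bilinear])

lemma hom_right: "x \<in> carrier M \<Longrightarrow> mod_hom K N P (b x)"
  by unfold_locales (rule bilinear_maps_hom_right[OF bilinear])

lemma closed [simp]: "x \<in> carrier M \<Longrightarrow> y \<in> carrier N \<Longrightarrow> b x y \<in> carrier P"
  using mod_hom.f_im[OF hom_right] by blast

lemma add_left: "x \<in> carrier M \<Longrightarrow> x' \<in> carrier M \<Longrightarrow> y \<in> carrier N
    \<Longrightarrow> b (x \<oplus>\<^bsub>M\<^esub> x') y = b x y \<oplus>\<^bsub>P\<^esub> b x' y"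
  using module_hom_add[OF bilinear_maps_hom_left[OF bilinear]] by simp

lemma add_right: "x \<in> carrier M \<Longrightarrow> y \<in> carrier N \<Longrightarrow> y' \<in> carrier N
    \<Longrightarrow> b x (y \<oplus>\<^bsub>N\<^esub> y') = b x y \<oplus>\<^bsub>P\<^esub> b x y'"
  using module_hom_add[OF bilinear_maps_hom_right[OF bilinear]] by simp

lemma smult_left: "c \<in> carrier K \<Longrightarrow> x \<in> carrier M \<Longrightarrow> y \<in> carrier N
    \<Longrightarrow> b (c \<odot>\<^bsub>M\<^esub> x) y = c \<odot>\<^bsub>P\<^esub> b x y"
  using module_hom_smult[OF bilinear_maps_hom_left[OF bilinear]] by simp

lemma smult_right: "c \<in> carrier K \<Longrightarrow> x \<in> carrier M \<Longrightarrow> y \<in> carrier N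
    \<Longrightarrow> b x (c \<odot>\<^bsub>N\<^esub> y) = c \<odot>\<^bsub>P\<^esub> b x y"
  using module_hom_smult[OF bilinear_maps_hom_right[OF bilinear]] by simp

lemma minus_left: "x \<in> carrier M \<Longrightarrow> x' \<in> carrier M \<Longrightarrow> y \<in> carrier N
    \<Longrightarrow> b (x \<ominus>\<^bsub>M\<^esub> x') y = b x y \<ominus>\<^bsub>P\<^esub> b x' y"
  using mod_hom.f_minus[OF hom_left] by simp

lemma neg_right: "x \<in> carrier M \<Longrightarrow> y \<in> carrier N \<Longrightarrow> b x (\<ominus>\<^bsub>N\<^esub> y) = \<ominus>\<^bsub>P\<^esub> b x y"
  using mod_hom.f_neg[OF hom_right] by simp

lemma zero_left [simp]: "y \<in> carrier N \<Longrightarrow> b \<zero>\<^bsub>M\<^esub> y = \<zero>\<^bsub>P\<^esub>"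
  using mod_hom.f0_is_0[OF hom_left] by simp

lemma zero_right [simp]: "x \<in> carrier M \<Longrightarrow> b x \<zero>\<^bsub>N\<^esub> = \<zero>\<^bsub>P\<^esub>"
  using mod_hom.f0_is_0[OF hom_right] by simp

end

text \<open>The section is the inverse of \<open>T\<close> on a subspace that is maximal among those
  meeting the kernel of \<open>T\<close> trivially.\<close>

lemma (in linear_map) surjective_has_section:
  assumes surj: "T ` carrier V = carrier W"
  shows "\<exists>s. s \<in> module_hom K W V \<and> (\<forall>x\<in>carrier W. T (s x) = x)"
proof -
  define C where "C = {S. submodule K S V \<and> (\<forall>v\<in>S. T v = \<zero>\<^bsub>W\<^esub> \<longrightarrow> v = \<zero>\<^bsub>V\<^esub>)}"
  have zero: "{\<zero>\<^bsub>V\<^esub>} \<in> C"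
    by (auto simp: C_def intro!: submodule.intro V.module.module_axioms)
  have chain: "\<Union>\<C> \<in> C" if ch: "subset.chain C \<C>" and ne: "\<C> \<noteq> {}" for \<C>
  proof -
    have sub: "submodule K S V" if "S \<in> \<C>" for S
      using ch that by (auto simp: subset.chain_def C_def)
    have "submodule K (\<Union>\<C>) V"
    proof (rule submodule.intro)
      show "\<Union>\<C> \<subseteq> carrier V" using submodule.subset[OF sub] by blast
      show "\<zero>\<^bsub>V\<^esub> \<in> \<Union>\<C>" using ne submodule.zero_closed[OF sub] by blast
      show "c \<odot>\<^bsub>V\<^esub> v \<in> \<Union>\<C>" if "c \<in> carrier K" "v \<in> \<Union>\<C>" for c v
        using that submodule.smult_closed[OF sub] by blast
      \<comment> \<open>Two vectors of the union lie in members of the chain that are comparable,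
        hence in the larger one.\<close>
      show "v \<oplus>\<^bsub>V\<^esub> w \<in> \<Union>\<C>" if vw: "v \<in> \<Union>\<C>" "w \<in> \<Union>\<C>" for v w
      proof -
        obtain A B where AB: "A \<in> \<C>" "v \<in> A" "B \<in> \<C>" "w \<in> B" using vw by blast
        then have "A \<subseteq> B \<or> B \<subseteq> A" using ch by (auto simp: subset.chain_def)
        then show ?thesis using AB submodule.m_closed[OF sub] by blast
      qed
    qed (rule V.module.module_axioms)
    then show ?thesis using ch by (auto simp: C_def subset.chain_def)
  qed
  obtain S where SC: "S \<in> C" and max: "\<And>S'. S' \<in> C \<Longrightarrow> S \<subseteq> S' \<Longrightarrow> S' = S"
    using subset_Zorn_nonempty[of C] zero chain by blast
  have sm: "submodule K S V" and triv: "\<And>v. v \<in> S \<Longrightarrow> T v = \<zero>\<^bsub>W\<^esub> \<Longrightarrow> v = \<zero>\<^bsub>V\<^esub>"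
    using SC by (auto simp: C_def)
  interpret S: submodule K S V by (rule sm)
  have SV [simp]: "v \<in> S \<Longrightarrow> v \<in> carrier V" for v using S.subset by blast
  have Sminus: "v \<ominus>\<^bsub>V\<^esub> w \<in> S" if "v \<in> S" "w \<in> S" for v w
  proof -
    \<comment> \<open>\<open>submodule\<close> provides closure under scalars but not under
      negation, so the negative is reached as a multiple by -1.\<close>
    have "(\<ominus>\<^bsub>K\<^esub> \<one>\<^bsub>K\<^esub>) \<odot>\<^bsub>V\<^esub> w \<in> S" using that by simp
    then have "\<ominus>\<^bsub>V\<^esub> w \<in> S" using that by (simp add: V.module.smult_minus_1)
    then show ?thesis using that by (simp add: a_minus_def)
  qed
  have inj: "inj_on T S"
  proof (rule inj_onI)
    fix v w assume vw: "v \<in> S" "w \<in> S" "T v = T w"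
    then have "T (v \<ominus>\<^bsub>V\<^esub> w) = \<zero>\<^bsub>W\<^esub>" by (simp add: a_minus_def W.module.M.r_neg)
    then have "v \<ominus>\<^bsub>V\<^esub> w = \<zero>\<^bsub>V\<^esub>" using triv Sminus vw by blast
    then show "v = w" using vw by simp
  qed
  have img: "T ` S = carrier W"
  proof (rule ccontr)
    assume "T ` S \<noteq> carrier W"
    then obtain x where x: "x \<in> carrier W" "x \<notin> T ` S" by auto
    from x(1) obtain e where e: "e \<in> carrier V" "T e = x"
      unfolding surj[symmetric] by (elim imageE) simp
    \<comment> \<open>The span of \<open>S\<close> and a preimage \<open>e\<close> of a missed
      vector \<open>x\<close>; it still meets the kernel trivially, against maximality.\<close>
    let ?S' = "{v \<oplus>\<^bsub>V\<^esub> c \<odot>\<^bsub>V\<^esub> e | v c. v \<in> S \<and> c \<in> carrier K}"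
    have "submodule K ?S' V"
    proof (rule submodule.intro)
      show "?S' \<subseteq> carrier V" using e by auto
      show "\<zero>\<^bsub>V\<^esub> \<in> ?S'" using e by (auto intro!: exI[of _ "\<zero>\<^bsub>V\<^esub>"] exI[of _ "\<zero>\<^bsub>K\<^esub>"])
      show "a \<odot>\<^bsub>V\<^esub> v \<in> ?S'" if av: "a \<in> carrier K" "v \<in> ?S'" for a v
      proof -
        obtain u c where "u \<in> S" "c \<in> carrier K" "v = u \<oplus>\<^bsub>V\<^esub> c \<odot>\<^bsub>V\<^esub> e" using av by blast
        then have "a \<odot>\<^bsub>V\<^esub> v = (a \<odot>\<^bsub>V\<^esub> u) \<oplus>\<^bsub>V\<^esub> (a \<otimes>\<^bsub>K\<^esub> c) \<odot>\<^bsub>V\<^esub> e"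
          "a \<odot>\<^bsub>V\<^esub> u \<in> S" "a \<otimes>\<^bsub>K\<^esub> c \<in> carrier K"
          using av e by (simp_all add: V.module.smult_r_distr V.module.smult_assoc1)
        then show ?thesis by blast
      qed
      show "v \<oplus>\<^bsub>V\<^esub> w \<in> ?S'" if vw: "v \<in> ?S'" "w \<in> ?S'" for v w
      proof -
        obtain u c u' c' where u: "u \<in> S" "c \<in> carrier K" "v = u \<oplus>\<^bsub>V\<^esub> c \<odot>\<^bsub>V\<^esub> e"
          "u' \<in> S" "c' \<in> carrier K" "w = u' \<oplus>\<^bsub>V\<^esub> c' \<odot>\<^bsub>V\<^esub> e" using vw by blast
        then have "v \<oplus>\<^bsub>V\<^esub> w = (u \<oplus>\<^bsub>V\<^esub> u') \<oplus>\<^bsub>V\<^esub> (c \<oplus>\<^bsub>K\<^esub> c') \<odot>\<^bsub>V\<^esub> e"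
          using e by (simp add: V.module.smult_l_distr V.module.M.a_ac)
        moreover have "u \<oplus>\<^bsub>V\<^esub> u' \<in> S" "c \<oplus>\<^bsub>K\<^esub> c' \<in> carrier K" using u by simp_all
        ultimately show ?thesis by blast
      qed
    qed (rule V.module.module_axioms)
    moreover have "v = \<zero>\<^bsub>V\<^esub>" if v: "v \<in> ?S'" "T v = \<zero>\<^bsub>W\<^esub>" for v
    proof -
      obtain u c where u: "u \<in> S" "c \<in> carrier K" "v = u \<oplus>\<^bsub>V\<^esub> c \<odot>\<^bsub>V\<^esub> e" using v(1) by auto
      then have eq: "T u \<oplus>\<^bsub>W\<^esub> c \<odot>\<^bsub>W\<^esub> x = \<zero>\<^bsub>W\<^esub>" using v e by simp
      \<comment> \<open>If \<open>c\<close> were invertible, T u + c x = 0 could be solved for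
        \<open>x\<close>, which would then be the image of a vector of \<open>S\<close>.\<close>
      have "c = \<zero>\<^bsub>K\<^esub>"
      proof (rule ccontr)
        assume "c \<noteq> \<zero>\<^bsub>K\<^esub>"
        then have "c \<in> Units K" using u V.field.field_Units by simp
        then have inv: "inv\<^bsub>K\<^esub> c \<in> carrier K" "inv\<^bsub>K\<^esub> c \<otimes>\<^bsub>K\<^esub> c = \<one>\<^bsub>K\<^esub>"
          by (rule V.module.R.Units_inv_closed, rule V.module.R.Units_l_inv)
        have "c \<odot>\<^bsub>W\<^esub> x = \<ominus>\<^bsub>W\<^esub> T u" using eq u x
          by (metis SV T_im W.module.M.a_comm W.module.M.minus_equality W.module.smult_closed)
        then have "x = inv\<^bsub>K\<^esub> c \<odot>\<^bsub>W\<^esub> (\<ominus>\<^bsub>W\<^esub> T u)"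
          using inv u x W.module.smult_assoc1[of "inv\<^bsub>K\<^esub> c" c x] by (simp add: W.module.smult_one)
        \<comment> \<open>The negative is written as zero minus \<open>u\<close> so that membership
          in \<open>S\<close> follows from \<open>Sminus\<close>.\<close>
        also have "\<dots> = T (inv\<^bsub>K\<^esub> c \<odot>\<^bsub>V\<^esub> (\<zero>\<^bsub>V\<^esub> \<ominus>\<^bsub>V\<^esub> u))"
          using inv u by (simp add: a_minus_def)
        also have "\<dots> \<in> T ` S"
          by (intro imageI S.smult_closed Sminus S.zero_closed inv(1) u(1))
        finally show False using x by simp
      qed
      then show ?thesis using u v triv[of u] e by simp
    qed
    ultimately have "?S' \<in> C" by (auto simp: C_def)
    moreover have "S \<subseteq> ?S'"
    proof
      fix v assume v: "v \<in> S"
      then have "v \<oplus>\<^bsub>V\<^esub> \<zero>\<^bsub>K\<^esub> \<odot>\<^bsub>V\<^esub> e \<in> ?S'" using V.module.R.zero_closed by blast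
      then show "v \<in> ?S'" using e v by (simp only: V.module.smult_l_null V.module.M.r_zero SV)
    qed
    ultimately have "?S' = S" by (rule max)
    moreover have "\<zero>\<^bsub>V\<^esub> \<oplus>\<^bsub>V\<^esub> \<one>\<^bsub>K\<^esub> \<odot>\<^bsub>V\<^esub> e \<in> ?S'"
      using S.zero_closed V.module.R.one_closed by blast
    then have "e \<in> ?S'" using e by (simp only: V.module.smult_one V.module.M.l_zero)
    ultimately show False using e x by blast
  qed
  define s where "s = inv_into S T"
  have s: "s x \<in> S" "T (s x) = x" if "x \<in> carrier W" for x
    using that img unfolding s_def by (auto intro: inv_into_into f_inv_into_f)
  \<comment> \<open>Preimages in \<open>S\<close> are unique; linearity of \<open>s\<close> follows
    by checking that the expected vector of \<open>S\<close> has the right image.\<close>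
  have s_eq: "s x = v" if "v \<in> S" "T v = x" for x v
    using that inj s_def by auto
  have "s \<in> module_hom K W V"
    unfolding module_hom_def using s by (auto intro!: s_eq)
  then show ?thesis using s by blast
qed

section \<open>Compatible products and twisted products\<close>

definition mixed_associator ::
  "('k, 'a, 'x) module_scheme \<Rightarrow> ('a \<Rightarrow> 'a \<Rightarrow> 'a) \<Rightarrow> ('a \<Rightarrow> 'a \<Rightarrow> 'a) \<Rightarrow> 'a \<Rightarrow> 'a \<Rightarrow> 'a \<Rightarrow> 'a" where
  "mixed_associator M \<pi> \<sigma> x y z = \<pi> (\<sigma> x y) z \<ominus>\<^bsub>M\<^esub> \<pi> x (\<sigma> y z)"

definition mixed_defect ::
  "('k, 'a, 'x) module_scheme \<Rightarrow> ('a \<Rightarrow> 'a \<Rightarrow> 'a) \<Rightarrow> ('a \<Rightarrow> 'a \<Rightarrow> 'a) \<Rightarrow> 'a \<Rightarrow> 'a \<Rightarrow> 'a \<Rightarrow> 'a" where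
  "mixed_defect M \<pi> \<sigma> x y z = mixed_associator M \<pi> \<sigma> x y z \<ominus>\<^bsub>M\<^esub> mixed_associator M \<pi> \<sigma> y x z"

text \<open>The products are arguments rather than record fields, so that the notion also applies to
  \<open>direct_sum G V\<close>, which is only a module and receives its products from
  outside.\<close>

definition compatible_products ::
  "('k, 'r) ring_scheme \<Rightarrow> ('k, 'a, 'x) module_scheme \<Rightarrow> ('a \<Rightarrow> 'a \<Rightarrow> 'a) \<Rightarrow> ('a \<Rightarrow> 'a \<Rightarrow> 'a) \<Rightarrow> bool" where
  "compatible_products K M \<pi> \<sigma> \<longleftrightarrow>
     vectorspace K M \<and> \<pi> \<in> bilinear_maps K M M M \<and> \<sigma> \<in> bilinear_maps K M M M \<and>
     (\<forall>x\<in>carrier M. \<forall>y\<in>carrier M. \<forall>z\<in>carrier M.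
        mixed_defect M \<pi> \<pi> x y z = \<zero>\<^bsub>M\<^esub> \<and> mixed_defect M \<sigma> \<sigma> x y z = \<zero>\<^bsub>M\<^esub> \<and>
        mixed_defect M \<pi> \<sigma> x y z \<oplus>\<^bsub>M\<^esub> mixed_defect M \<sigma> \<pi> x y z = \<zero>\<^bsub>M\<^esub>)"

lemma (in abelian_group) minus_eq_zero_iff:
  "a \<in> carrier G \<Longrightarrow> b \<in> carrier G \<Longrightarrow> a \<ominus> b = \<zero> \<longleftrightarrow> a = b"
  by (metis a_minus_def minus_equality minus_minus r_neg add.inv_closed)

lemma (in abelian_group) minus_eq_iff:
  assumes "a \<in> carrier G" "b \<in> carrier G" "c \<in> carrier G"
  shows "a \<ominus> b = c \<longleftrightarrow> a = b \<oplus> c"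
proof -
  have "a = b \<oplus> (a \<ominus> b)" "(b \<oplus> c) \<ominus> b = c"
    using assms by (metis minus_eq a_lcomm a_inv_closed r_neg r_zero, metis minus_eq a_comm r_neg1 a_inv_closed a_closed a_assoc l_neg l_zero)
  then show ?thesis by metis
qed

lemma vectorspace_module: "vectorspace K V \<Longrightarrow> module K V"
  by (simp add: vectorspace_def)

lemma vectorspace_abelian_group: "vectorspace K V \<Longrightarrow> abelian_group V"
  by (simp add: vectorspace_def module_def)

text \<open>The eight-term identity is the sum of the two mixed defects regrouped. Bilinearity is
  used for closure: the group laws hold only on the carrier.\<close>

lemma compatible_pre_lie_algebra_iff:
  "compatible_pre_lie_algebra K G \<longleftrightarrow> compatible_products K G (pdot G) (past G)"
proof -
  have "(\<forall>x\<in>carrier G. \<forall>y\<in>carrier G. \<forall>z\<in>carrier G.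
          \<pi> (\<pi> x y) z \<ominus>\<^bsub>G\<^esub> \<pi> x (\<pi> y z) = \<pi> (\<pi> y x) z \<ominus>\<^bsub>G\<^esub> \<pi> y (\<pi> x z)) \<longleftrightarrow>
        (\<forall>x\<in>carrier G. \<forall>y\<in>carrier G. \<forall>z\<in>carrier G. mixed_defect G \<pi> \<pi> x y z = \<zero>\<^bsub>G\<^esub>)"
    if "vectorspace K G" "\<pi> \<in> bilinear_maps K G G G" for \<pi>
  proof -
    interpret G: abelian_group G using that(1) by (rule vectorspace_abelian_group)
    interpret p: bilinear_map K G G G \<pi>
      using that by (simp add: bilinear_map_def bilinear_map_axioms_def vectorspace_module)
    show ?thesis by (simp add: mixed_defect_def mixed_associator_def G.minus_eq_zero_iff)
  qed
  moreover have "(x \<star>\<^bsub>G\<^esub> y) \<bullet>\<^bsub>G\<^esub> z \<oplus>\<^bsub>G\<^esub> (x \<bullet>\<^bsub>G\<^esub> y) \<star>\<^bsub>G\<^esub> z \<ominus>\<^bsub>G\<^esub> x \<bullet>\<^bsub>G\<^esub> (y \<star>\<^bsub>G\<^esub> z) \<ominus>\<^bsub>G\<^esub> x \<star>\<^bsub>G\<^esub> (y \<bullet>\<^bsub>G\<^esub> z)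
        \<ominus>\<^bsub>G\<^esub> (y \<star>\<^bsub>G\<^esub> x) \<bullet>\<^bsub>G\<^esub> z \<ominus>\<^bsub>G\<^esub> (y \<bullet>\<^bsub>G\<^esub> x) \<star>\<^bsub>G\<^esub> z \<oplus>\<^bsub>G\<^esub> y \<bullet>\<^bsub>G\<^esub> (x \<star>\<^bsub>G\<^esub> z) \<oplus>\<^bsub>G\<^esub> y \<star>\<^bsub>G\<^esub> (x \<bullet>\<^bsub>G\<^esub> z)
      = mixed_defect G (pdot G) (past G) x y z \<oplus>\<^bsub>G\<^esub> mixed_defect G (past G) (pdot G) x y z"
    if "vectorspace K G" "pdot G \<in> bilinear_maps K G G G" "past G \<in> bilinear_maps K G G G"
      "x \<in> carrier G" "y \<in> carrier G" "z \<in> carrier G" for x y z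
  proof -
    interpret G: abelian_group G using that(1) by (rule vectorspace_abelian_group)
    interpret p: bilinear_map K G G G "pdot G"
      using that by (simp add: bilinear_map_def bilinear_map_axioms_def vectorspace_module)
    interpret q: bilinear_map K G G G "past G"
      using that by (simp add: bilinear_map_def bilinear_map_axioms_def vectorspace_module)
    show ?thesis using that
      by (simp add: mixed_defect_def mixed_associator_def G.minus_eq G.minus_add G.a_ac)
  qed
  ultimately show ?thesis
    unfolding compatible_pre_lie_algebra_def compatible_products_def pre_lie_algebra_def
    by (smt (verit))
qed

text \<open>Each axiom is an equation, and injectivity lets it be checked after applying \<phi>.
  Negatives are requested as preimages because negation in \<open>M\<close> has no known properties
  before \<open>M\<close> is a group. This serves structures copied onto another type.\<close>

lemma vectorspace_pullback:
  assumes "vectorspace K E"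
    and im: "\<And>x. x \<in> carrier M \<Longrightarrow> \<phi> x \<in> carrier E" and inj: "inj_on \<phi> (carrier M)"
    and zero: "\<zero>\<^bsub>M\<^esub> \<in> carrier M" "\<phi> \<zero>\<^bsub>M\<^esub> = \<zero>\<^bsub>E\<^esub>"
    and neg: "\<And>x. x \<in> carrier M \<Longrightarrow> \<exists>y\<in>carrier M. \<phi> y = \<ominus>\<^bsub>E\<^esub> \<phi> x"
    and add: "\<And>x y. x \<in> carrier M \<Longrightarrow> y \<in> carrier M \<Longrightarrow> x \<oplus>\<^bsub>M\<^esub> y \<in> carrier M"
      "\<And>x y. x \<in> carrier M \<Longrightarrow> y \<in> carrier M \<Longrightarrow> \<phi> (x \<oplus>\<^bsub>M\<^esub> y) = \<phi> x \<oplus>\<^bsub>E\<^esub> \<phi> y"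
    and smult: "\<And>c x. c \<in> carrier K \<Longrightarrow> x \<in> carrier M \<Longrightarrow> c \<odot>\<^bsub>M\<^esub> x \<in> carrier M"
      "\<And>c x. c \<in> carrier K \<Longrightarrow> x \<in> carrier M \<Longrightarrow> \<phi> (c \<odot>\<^bsub>M\<^esub> x) = c \<odot>\<^bsub>E\<^esub> \<phi> x"
  shows "vectorspace K M"
proof -
  interpret EA: abelian_group E using assms(1) by (rule vectorspace_abelian_group)
  interpret E: vectorspace K E by (rule assms(1))
  have eq: "x = y" if "\<phi> x = \<phi> y" "x \<in> carrier M" "y \<in> carrier M" for x y
    using inj that by (simp add: inj_on_eq_iff)
  have "abelian_group M"
  proof (rule abelian_groupI)
    fix x assume x: "x \<in> carrier M"
    then obtain y where "y \<in> carrier M" "\<phi> y = \<ominus>\<^bsub>E\<^esub> \<phi> x" using neg by blast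
    then show "\<exists>y\<in>carrier M. y \<oplus>\<^bsub>M\<^esub> x = \<zero>\<^bsub>M\<^esub>"
      using x by (intro bexI[of _ y] eq) (simp_all add: add zero im EA.l_neg)
  qed (rule eq; simp add: add zero im EA.a_ac | simp add: add zero)+
  moreover have "cring K" by (rule E.module.R.is_cring)
  ultimately have "module K M"
    by (intro moduleI)
      (rule eq; simp add: add smult im E.module.smult_l_distr E.module.smult_r_distr
        E.module.smult_assoc1 E.module.smult_one E.module.R.a_closed E.module.R.m_closed E.module.R.one_closed
      | simp add: smult)+
  then show ?thesis using assms(1) by (simp add: vectorspace_def)
qed

text \<open>A multiplicative linear map carries defects to defects, and an injective one reflects
  their vanishing. It is used in both directions: along the chart, to transfer the axioms of an
  extension to pairs, and along the inverse of an injection, to transfer them from pairs to a copy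
  in \<open>'e\<close>.\<close>

lemma compatible_products_pullback:
  assumes E: "compatible_products K E \<tau> \<tau>'" and M: "vectorspace K M"
    and hom: "\<phi> \<in> module_hom K M E" and inj: "inj_on \<phi> (carrier M)"
    and \<pi>: "\<And>x y. x \<in> carrier M \<Longrightarrow> y \<in> carrier M \<Longrightarrow> \<pi> x y \<in> carrier M"
      "\<And>x y. x \<in> carrier M \<Longrightarrow> y \<in> carrier M \<Longrightarrow> \<phi> (\<pi> x y) = \<tau> (\<phi> x) (\<phi> y)"
    and \<sigma>: "\<And>x y. x \<in> carrier M \<Longrightarrow> y \<in> carrier M \<Longrightarrow> \<sigma> x y \<in> carrier M"
      "\<And>x y. x \<in> carrier M \<Longrightarrow> y \<in> carrier M \<Longrightarrow> \<phi> (\<sigma> x y) = \<tau>' (\<phi> x) (\<phi> y)"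
  shows "compatible_products K M \<pi> \<sigma>"
proof -
  interpret EA: abelian_group E
    using E by (auto simp: compatible_products_def intro: vectorspace_abelian_group)
  interpret MA: abelian_group M using M by (rule vectorspace_abelian_group)
  interpret t: bilinear_map K E E E \<tau>
    using E by (simp add: compatible_products_def bilinear_map_def bilinear_map_axioms_def vectorspace_module)
  interpret t': bilinear_map K E E E \<tau>'
    using E by (simp add: compatible_products_def bilinear_map_def bilinear_map_axioms_def vectorspace_module)
  interpret M: module K M using M by (rule vectorspace_module)
  interpret \<phi>: mod_hom K M E \<phi> by unfold_locales (rule hom)
  have eq: "x = y" if "\<phi> x = \<phi> y" "x \<in> carrier M" "y \<in> carrier M" for x y
    using inj that by (simp add: inj_on_eq_iff)
  have "\<pi> \<in> bilinear_maps K M M M"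
    by (rule bilinear_mapsI; (rule \<pi>(1) | rule eq);
        simp add: \<pi> t.add_left t.add_right t.smult_left t.smult_right)
  moreover have "\<sigma> \<in> bilinear_maps K M M M"
    by (rule bilinear_mapsI; (rule \<sigma>(1) | rule eq);
        simp add: \<sigma> t'.add_left t'.add_right t'.smult_left t'.smult_right)
  moreover have closed: "mixed_defect M \<alpha> \<beta> x y z \<in> carrier M"
    if "\<alpha> \<in> {\<pi>, \<sigma>}" "\<beta> \<in> {\<pi>, \<sigma>}" "x \<in> carrier M" "y \<in> carrier M" "z \<in> carrier M" for \<alpha> \<beta> x y z
    using that by (auto simp: mixed_defect_def mixed_associator_def \<pi> \<sigma>)
  have "\<phi> (mixed_defect M \<pi> \<pi> x y z) = mixed_defect E \<tau> \<tau> (\<phi> x) (\<phi> y) (\<phi> z)"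
    "\<phi> (mixed_defect M \<sigma> \<sigma> x y z) = mixed_defect E \<tau>' \<tau>' (\<phi> x) (\<phi> y) (\<phi> z)"
    "\<phi> (mixed_defect M \<pi> \<sigma> x y z) = mixed_defect E \<tau> \<tau>' (\<phi> x) (\<phi> y) (\<phi> z)"
    "\<phi> (mixed_defect M \<sigma> \<pi> x y z) = mixed_defect E \<tau>' \<tau> (\<phi> x) (\<phi> y) (\<phi> z)"
    if "x \<in> carrier M" "y \<in> carrier M" "z \<in> carrier M" for x y z
    using that by (simp_all add: mixed_defect_def mixed_associator_def \<pi> \<sigma>)
  then have "mixed_defect M \<pi> \<pi> x y z = \<zero>\<^bsub>M\<^esub> \<and> mixed_defect M \<sigma> \<sigma> x y z = \<zero>\<^bsub>M\<^esub> \<and>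
        mixed_defect M \<pi> \<sigma> x y z \<oplus>\<^bsub>M\<^esub> mixed_defect M \<sigma> \<pi> x y z = \<zero>\<^bsub>M\<^esub>"
    if "x \<in> carrier M" "y \<in> carrier M" "z \<in> carrier M" for x y z
    using that E closed by (intro conjI eq) (simp_all add: compatible_products_def)
  ultimately show ?thesis using M by (simp add: compatible_products_def)
qed

section \<open>Twisted products: semidirect products deformed by a cochain\<close>

definition twisted_product ::
  "('k, 'v, 'y) module_scheme \<Rightarrow> ('g \<Rightarrow> 'g \<Rightarrow> 'g) \<Rightarrow> ('g \<Rightarrow> 'v \<Rightarrow> 'v) \<Rightarrow> ('g \<Rightarrow> 'v \<Rightarrow> 'v)
    \<Rightarrow> ('g \<Rightarrow> 'g \<Rightarrow> 'v) \<Rightarrow> 'g \<times> 'v \<Rightarrow> 'g \<times> 'v \<Rightarrow> 'g \<times> 'v" where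
  "twisted_product V \<pi> r m \<omega> =
     (\<lambda>(x, u) (y, v). (\<pi> x y, \<omega> x y \<oplus>\<^bsub>V\<^esub> r x v \<oplus>\<^bsub>V\<^esub> m y u))"

lemma twisted_product_simp [simp]:
  "twisted_product V \<pi> r m \<omega> (x, u) (y, v) = (\<pi> x y, \<omega> x y \<oplus>\<^bsub>V\<^esub> r x v \<oplus>\<^bsub>V\<^esub> m y u)"
  by (simp add: twisted_product_def)

lemma direct_sum_simps [simp]:
  "carrier (direct_sum G V) = carrier G \<times> carrier V"
  "\<zero>\<^bsub>direct_sum G V\<^esub> = (\<zero>\<^bsub>G\<^esub>, \<zero>\<^bsub>V\<^esub>)"
  "(x, u) \<oplus>\<^bsub>direct_sum G V\<^esub> (y, v) = (x \<oplus>\<^bsub>G\<^esub> y, u \<oplus>\<^bsub>V\<^esub> v)"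
  "c \<odot>\<^bsub>direct_sum G V\<^esub> (x, u) = (c \<odot>\<^bsub>G\<^esub> x, c \<odot>\<^bsub>V\<^esub> u)"
  by (simp_all add: direct_sum_def)

lemma direct_sum_minus:
  assumes "module K G" "module K V" "x \<in> carrier G" "y \<in> carrier G" "u \<in> carrier V" "v \<in> carrier V"
  shows "(x, u) \<ominus>\<^bsub>direct_sum G V\<^esub> (y, v) = (x \<ominus>\<^bsub>G\<^esub> y, u \<ominus>\<^bsub>V\<^esub> v)"
proof -
  interpret GA: abelian_group G using assms(1) by (simp add: module_def)
  interpret VA: abelian_group V using assms(2) by (simp add: module_def)
  interpret DA: abelian_group "direct_sum G V"
    using direct_sum_is_module[OF assms(1,2)] by (simp add: module_def)
  have "\<ominus>\<^bsub>direct_sum G V\<^esub> (y, v) = (\<ominus>\<^bsub>G\<^esub> y, \<ominus>\<^bsub>V\<^esub> v)"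
    using assms by (intro DA.minus_equality) (simp_all add: GA.l_neg VA.l_neg)
  then show ?thesis by (simp add: a_minus_def)
qed

lemma direct_sum_vectorspace:
  "vectorspace K G \<Longrightarrow> vectorspace K V \<Longrightarrow> vectorspace K (direct_sum G V)"
  by (simp add: vectorspace_def direct_sum_is_module)

text \<open>Each summand of the \<open>V\<close>-component is linear in both pairs: every one
  combines exactly one entry of the first pair with one of the second.\<close>

lemma twisted_product_bilinear:
  assumes "module K G" "module K V" and \<pi>: "\<pi> \<in> bilinear_maps K G G G"
    and r: "r \<in> bilinear_maps K G V V" and m: "m \<in> bilinear_maps K G V V"
    and \<omega>: "\<omega> \<in> bilinear_maps K G G V"
  shows "twisted_product V \<pi> r m \<omega>
    \<in> bilinear_maps K (direct_sum G V) (direct_sum G V) (direct_sum G V)"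
proof -
  interpret VA: abelian_group V using assms(2) by (simp add: module_def)
  interpret V: module K V by (rule assms(2))
  interpret p: bilinear_map K G G G \<pi>
    using assms by (simp add: bilinear_map_def bilinear_map_axioms_def)
  interpret r: bilinear_map K G V V r
    using assms by (simp add: bilinear_map_def bilinear_map_axioms_def)
  interpret m: bilinear_map K G V V m
    using assms by (simp add: bilinear_map_def bilinear_map_axioms_def)
  interpret w: bilinear_map K G G V \<omega>
    using assms by (simp add: bilinear_map_def bilinear_map_axioms_def)
  show ?thesis
    by (rule bilinear_mapsI)
      (auto simp: p.add_left p.add_right r.add_left r.add_right m.add_left m.add_right
        w.add_left w.add_right p.smult_left p.smult_right r.smult_left r.smult_right
        m.smult_left m.smult_right w.smult_left w.smult_right V.smult_r_distr VA.a_ac)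
qed

text \<open>The coefficients of \<open>w\<close>, \<open>v\<close> and \<open>u\<close> in the \<open>V\<close>-component of the mixed associator of
  \<open>(x, u)\<close>, \<open>(y, v)\<close>, \<open>(z, w)\<close> are the three action terms below.\<close>

definition left_action_defect where
  "left_action_defect V \<sigma> r r' x y w = r (\<sigma> x y) w \<ominus>\<^bsub>V\<^esub> r x (r' y w)"

definition middle_action_defect where
  "middle_action_defect V r m r' m' x z v = m z (r' x v) \<ominus>\<^bsub>V\<^esub> r x (m' z v)"

definition right_action_defect where
  "right_action_defect V \<sigma> m m' y z u = m z (m' y u) \<ominus>\<^bsub>V\<^esub> m (\<sigma> y z) u"

definition cochain_associator where
  "cochain_associator V \<sigma> r m \<omega> \<omega>' x y z =
     \<omega> (\<sigma> x y) z \<oplus>\<^bsub>V\<^esub> m z (\<omega>' x y) \<ominus>\<^bsub>V\<^esub> \<omega> x (\<sigma> y z) \<ominus>\<^bsub>V\<^esub> r x (\<omega>' y z)"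

lemmas action_defs =
  left_action_defect_def middle_action_defect_def right_action_defect_def cochain_associator_def

text \<open>Two unrelated sets of twisting data on the same spaces, so that a single computation
  covers both pure defects and both mixed ones.\<close>

locale twisted_pair = G: module K G + V: module K V +
  p: bilinear_map K G G G \<pi> + r: bilinear_map K G V V r + m: bilinear_map K G V V m +
  w: bilinear_map K G G V \<omega> +
  p': bilinear_map K G G G \<pi>' + r': bilinear_map K G V V r' + m': bilinear_map K G V V m' +
  w': bilinear_map K G G V \<omega>'
  for K G V \<pi> r m \<omega> \<pi>' r' m' \<omega>'
begin

lemma mixed_associator_twisted:
  assumes "x \<in> carrier G" "y \<in> carrier G" "z \<in> carrier G"
    and "u \<in> carrier V" "v \<in> carrier V" "w \<in> carrier V"
  shows "mixed_associator (direct_sum G V) (twisted_product V \<pi> r m \<omega>) (twisted_product V \<pi>' r' m' \<omega>')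
      (x, u) (y, v) (z, w)
    = (mixed_associator G \<pi> \<pi>' x y z,
       cochain_associator V \<pi>' r m \<omega> \<omega>' x y z \<oplus>\<^bsub>V\<^esub> left_action_defect V \<pi>' r r' x y w
       \<oplus>\<^bsub>V\<^esub> middle_action_defect V r m r' m' x z v \<oplus>\<^bsub>V\<^esub> right_action_defect V \<pi>' m m' y z u)"
proof -
  have "module K G" "module K V" by unfold_locales
  then show ?thesis using assms
    by (simp add: mixed_associator_def direct_sum_minus[of K] action_defs
        r.add_right m.add_right V.M.minus_eq V.M.minus_add V.M.a_ac)
qed

text \<open>Exchanging the first two arguments also exchanges \<open>u\<close> and \<open>v\<close>,
  so the coefficient of \<open>v\<close> collects a middle term from one associator and a right term
  from the other; likewise for \<open>u\<close>, with the opposite sign. This is the grouping in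
  which the representation axioms apply.\<close>

lemma mixed_defect_twisted:
  assumes "x \<in> carrier G" "y \<in> carrier G" "z \<in> carrier G"
    and "u \<in> carrier V" "v \<in> carrier V" "w \<in> carrier V"
  shows "mixed_defect (direct_sum G V) (twisted_product V \<pi> r m \<omega>) (twisted_product V \<pi>' r' m' \<omega>')
      (x, u) (y, v) (z, w)
    = (mixed_defect G \<pi> \<pi>' x y z,
       (cochain_associator V \<pi>' r m \<omega> \<omega>' x y z \<ominus>\<^bsub>V\<^esub> cochain_associator V \<pi>' r m \<omega> \<omega>' y x z)
       \<oplus>\<^bsub>V\<^esub> (left_action_defect V \<pi>' r r' x y w \<ominus>\<^bsub>V\<^esub> left_action_defect V \<pi>' r r' y x w)
       \<oplus>\<^bsub>V\<^esub> (middle_action_defect V r m r' m' x z v \<ominus>\<^bsub>V\<^esub> right_action_defect V \<pi>' m m' x z v)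
       \<ominus>\<^bsub>V\<^esub> (middle_action_defect V r m r' m' y z u \<ominus>\<^bsub>V\<^esub> right_action_defect V \<pi>' m m' y z u))"
proof -
  have "module K G" "module K V" by unfold_locales
  moreover have "mixed_associator G \<pi> \<pi>' x y z \<in> carrier G" "mixed_associator G \<pi> \<pi>' y x z \<in> carrier G"
    using assms by (simp_all add: mixed_associator_def)
  moreover have "cochain_associator V \<pi>' r m \<omega> \<omega>' a b c \<in> carrier V"
    "left_action_defect V \<pi>' r r' a b t \<in> carrier V"
    "middle_action_defect V r m r' m' a c t \<in> carrier V"
    "right_action_defect V \<pi>' m m' b c t \<in> carrier V"
    if "a \<in> carrier G" "b \<in> carrier G" "c \<in> carrier G" "t \<in> carrier V" for a b c t
    using that by (simp_all add: action_defs)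
  ultimately show ?thesis using assms
    by (simp add: mixed_defect_def[of "direct_sum G V"] mixed_associator_twisted direct_sum_minus[of K]
        V.M.minus_eq V.M.minus_add V.M.a_ac)
      (simp add: mixed_defect_def a_minus_def)
qed

end

section \<open>Representation axioms, cocycle conditions and compatibility of twisted
  products\<close>

locale compat_rep =
  fixes K :: "('k, 'r) ring_scheme" and G :: "('k, 'g) compat_pre_lie" and V :: "('k, 'v) compat_pre_lie"
    and \<rho> \<mu> \<rho>' \<mu>' :: "'g \<Rightarrow> 'v \<Rightarrow> 'v"
  assumes G: "compatible_pre_lie_algebra K G"
    and V: "abelian_compatible_pre_lie_algebra K V"
    and rep: "compat_representation K G V \<rho> \<mu> \<rho>' \<mu>'"
begin

lemma compatible_G: "compatible_products K G (pdot G) (past G)"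
  using G by (simp add: compatible_pre_lie_algebra_iff)

lemma vectorspace_G: "vectorspace K G"
  using compatible_G by (simp add: compatible_products_def)

lemma vectorspace_V: "vectorspace K V"
  using rep by (simp add: compat_representation_def)

sublocale G: module K G using vectorspace_G by (rule vectorspace_module)
sublocale V: module K V using vectorspace_V by (rule vectorspace_module)

sublocale p: bilinear_map K G G G "pdot G"
  using compatible_G by unfold_locales (simp add: compatible_products_def)
sublocale p': bilinear_map K G G G "past G"
  using compatible_G by unfold_locales (simp add: compatible_products_def)
sublocale r: bilinear_map K G V V \<rho>
  using rep by unfold_locales (simp add: compat_representation_def pre_lie_representation_def)
sublocale m: bilinear_map K G V V \<mu>
  using rep by unfold_locales (simp add: compat_representation_def pre_lie_representation_def)
sublocale r': bilinear_map K G V V \<rho>'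
  using rep by unfold_locales (simp add: compat_representation_def pre_lie_representation_def)
sublocale m': bilinear_map K G V V \<mu>'
  using rep by unfold_locales (simp add: compat_representation_def pre_lie_representation_def)

text \<open>The first representation axiom, after splitting the action of the commutator by
  linearity, regrouped as the coefficient of \<open>w\<close> in a pure defect.\<close>

lemma representation_left:
  assumes "pre_lie_representation K G \<pi> V r m" and "\<pi> \<in> bilinear_maps K G G G"
    and "x \<in> carrier G" "y \<in> carrier G" "u \<in> carrier V"
  shows "left_action_defect V \<pi> r r x y u \<ominus>\<^bsub>V\<^esub> left_action_defect V \<pi> r r y x u = \<zero>\<^bsub>V\<^esub>"
proof -
  interpret q: bilinear_map K G G G \<pi> by unfold_locales (rule assms(2))
  interpret s: bilinear_map K G V V r
    using assms(1) by unfold_locales (simp add: pre_lie_representation_def)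
  have "r (\<pi> x y) u \<ominus>\<^bsub>V\<^esub> r (\<pi> y x) u = r x (r y u) \<ominus>\<^bsub>V\<^esub> r y (r x u)"
    using assms by (simp add: pre_lie_representation_def flip: s.minus_left)
  moreover have "left_action_defect V \<pi> r r x y u \<ominus>\<^bsub>V\<^esub> left_action_defect V \<pi> r r y x u
      = (r (\<pi> x y) u \<ominus>\<^bsub>V\<^esub> r (\<pi> y x) u) \<ominus>\<^bsub>V\<^esub> (r x (r y u) \<ominus>\<^bsub>V\<^esub> r y (r x u))"
    using assms by (simp add: left_action_defect_def V.M.minus_eq V.M.minus_add V.M.a_ac)
  ultimately show ?thesis using assms by (simp add: V.M.minus_eq_zero_iff)
qed

lemma representation_middle:
  assumes "pre_lie_representation K G \<pi> V r m"
    and "x \<in> carrier G" "y \<in> carrier G" "u \<in> carrier V"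
  shows "middle_action_defect V r m r m x y u = right_action_defect V \<pi> m m x y u"
  using assms by (simp add: pre_lie_representation_def action_defs)

lemma compat_representation_left:
  assumes "x \<in> carrier G" "y \<in> carrier G" "u \<in> carrier V"
  shows "(left_action_defect V (past G) \<rho> \<rho>' x y u \<ominus>\<^bsub>V\<^esub> left_action_defect V (past G) \<rho> \<rho>' y x u)
    \<oplus>\<^bsub>V\<^esub> (left_action_defect V (pdot G) \<rho>' \<rho> x y u \<ominus>\<^bsub>V\<^esub> left_action_defect V (pdot G) \<rho>' \<rho> y x u) = \<zero>\<^bsub>V\<^esub>"
    (is "?l = _")
proof -
  have "?l = (\<rho> (x \<star>\<^bsub>G\<^esub> y) u \<oplus>\<^bsub>V\<^esub> \<rho>' (x \<bullet>\<^bsub>G\<^esub> y) u \<ominus>\<^bsub>V\<^esub> \<rho> x (\<rho>' y u) \<ominus>\<^bsub>V\<^esub> \<rho>' x (\<rho> y u))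
    \<ominus>\<^bsub>V\<^esub> (\<rho> (y \<star>\<^bsub>G\<^esub> x) u \<oplus>\<^bsub>V\<^esub> \<rho>' (y \<bullet>\<^bsub>G\<^esub> x) u \<ominus>\<^bsub>V\<^esub> \<rho> y (\<rho>' x u) \<ominus>\<^bsub>V\<^esub> \<rho>' y (\<rho> x u))"
    using assms by (simp add: left_action_defect_def V.M.minus_eq V.M.minus_add V.M.a_ac)
  then show ?thesis using assms rep
    by (simp add: compat_representation_def V.M.minus_eq_zero_iff)
qed

text \<open>The second mixed axiom with all terms on one side. The mixed differences need not vanish
  separately; only the sum over both orders of the products is controlled.\<close>

lemma compat_representation_middle:
  assumes "x \<in> carrier G" "y \<in> carrier G" "u \<in> carrier V"
  shows "(middle_action_defect V \<rho> \<mu> \<rho>' \<mu>' x y u \<ominus>\<^bsub>V\<^esub> right_action_defect V (past G) \<mu> \<mu>' x y u)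
    \<oplus>\<^bsub>V\<^esub> (middle_action_defect V \<rho>' \<mu>' \<rho> \<mu> x y u \<ominus>\<^bsub>V\<^esub> right_action_defect V (pdot G) \<mu>' \<mu> x y u) = \<zero>\<^bsub>V\<^esub>"
    (is "?l = _")
proof -
  have "?l = (\<mu> y (\<rho>' x u) \<ominus>\<^bsub>V\<^esub> \<rho> x (\<mu>' y u) \<ominus>\<^bsub>V\<^esub> \<mu> y (\<mu>' x u) \<oplus>\<^bsub>V\<^esub> \<mu> (x \<star>\<^bsub>G\<^esub> y) u)
    \<ominus>\<^bsub>V\<^esub> (\<ominus>\<^bsub>V\<^esub> \<mu>' y (\<rho> x u) \<oplus>\<^bsub>V\<^esub> \<rho>' x (\<mu> y u) \<oplus>\<^bsub>V\<^esub> \<mu>' y (\<mu> x u) \<ominus>\<^bsub>V\<^esub> \<mu>' (x \<bullet>\<^bsub>G\<^esub> y) u)"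
    using assms by (simp add: action_defs V.M.minus_eq V.M.minus_add V.M.a_ac)
  then show ?thesis using assms rep
    by (simp add: compat_representation_def V.M.minus_eq_zero_iff)
qed

text \<open>The differential on 2-cochains is, up to sign, the part of a pure defect that remains
  when the \<open>V\<close>-entries are zero; this explains its formula.\<close>

lemma cobd2_conv_associator:
  assumes "\<pi> \<in> bilinear_maps K G G G" "r \<in> bilinear_maps K G V V" "m \<in> bilinear_maps K G V V"
    and "\<omega> \<in> bilinear_maps K G G V" and "x \<in> carrier G" "y \<in> carrier G" "z \<in> carrier G"
  shows "cochain_associator V \<pi> r m \<omega> \<omega> x y z \<ominus>\<^bsub>V\<^esub> cochain_associator V \<pi> r m \<omega> \<omega> y x z
    = \<ominus>\<^bsub>V\<^esub> cobd2 G \<pi> V r m \<omega> x y z"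
proof -
  interpret q: bilinear_map K G G G \<pi> by unfold_locales (rule assms)
  interpret s: bilinear_map K G V V r by unfold_locales (rule assms)
  interpret n: bilinear_map K G V V m by unfold_locales (rule assms)
  interpret w: bilinear_map K G G V \<omega> by unfold_locales (rule assms)
  show ?thesis using assms
    by (simp add: cobd2_def cochain_associator_def w.minus_left V.M.minus_eq V.M.minus_add V.M.a_ac)
qed

text \<open>Each mixed expression evaluates one cochain on products and lets the actions hit the
  other, so neither is a coboundary expression by itself. In the sum the terms exchange partners:
  \<omega>1 meets the data of the second product and \<omega>2 those of the first.\<close>

lemma cobd2_conv_mixed_associator:
  assumes "\<omega>1 \<in> bilinear_maps K G G V" "\<omega>2 \<in> bilinear_maps K G G V"
    and "x \<in> carrier G" "y \<in> carrier G" "z \<in> carrier G"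
  shows "(cochain_associator V (past G) \<rho> \<mu> \<omega>1 \<omega>2 x y z \<ominus>\<^bsub>V\<^esub> cochain_associator V (past G) \<rho> \<mu> \<omega>1 \<omega>2 y x z)
    \<oplus>\<^bsub>V\<^esub> (cochain_associator V (pdot G) \<rho>' \<mu>' \<omega>2 \<omega>1 x y z \<ominus>\<^bsub>V\<^esub> cochain_associator V (pdot G) \<rho>' \<mu>' \<omega>2 \<omega>1 y x z)
    = \<ominus>\<^bsub>V\<^esub> (cobd2 G (past G) V \<rho>' \<mu>' \<omega>1 x y z \<oplus>\<^bsub>V\<^esub> cobd2 G (pdot G) V \<rho> \<mu> \<omega>2 x y z)"
proof -
  interpret w: bilinear_map K G G V \<omega>1 by unfold_locales (rule assms)
  interpret w': bilinear_map K G G V \<omega>2 by unfold_locales (rule assms)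
  show ?thesis using assms
    by (simp add: cobd2_def cochain_associator_def w.minus_left w'.minus_left
        V.M.minus_eq V.M.minus_add V.M.a_ac)
qed

lemma cobd2_closed:
  assumes "\<pi> \<in> bilinear_maps K G G G" "r \<in> bilinear_maps K G V V" "m \<in> bilinear_maps K G V V"
    and "\<omega> \<in> bilinear_maps K G G V" and "x \<in> carrier G" "y \<in> carrier G" "z \<in> carrier G"
  shows "cobd2 G \<pi> V r m \<omega> x y z \<in> carrier V"
proof -
  interpret q: bilinear_map K G G G \<pi> by unfold_locales (rule assms)
  interpret s: bilinear_map K G V V r by unfold_locales (rule assms)
  interpret n: bilinear_map K G V V m by unfold_locales (rule assms)
  interpret w: bilinear_map K G G V \<omega> by unfold_locales (rule assms)
  show ?thesis using assms by (simp add: cobd2_def)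
qed

text \<open>The equations of \<open>cocycles2\<close> without the requirement that cochains be
  extensional, so that they make sense for any bilinear maps.\<close>

definition cocycle :: "('g \<Rightarrow> 'g \<Rightarrow> 'v) \<Rightarrow> ('g \<Rightarrow> 'g \<Rightarrow> 'v) \<Rightarrow> bool" where
  "cocycle \<omega>1 \<omega>2 \<longleftrightarrow> (\<forall>x\<in>carrier G. \<forall>y\<in>carrier G. \<forall>z\<in>carrier G.
     cobd2 G (pdot G) V \<rho> \<mu> \<omega>1 x y z = \<zero>\<^bsub>V\<^esub> \<and>
     cobd2 G (past G) V \<rho>' \<mu>' \<omega>1 x y z \<oplus>\<^bsub>V\<^esub> cobd2 G (pdot G) V \<rho> \<mu> \<omega>2 x y z = \<zero>\<^bsub>V\<^esub> \<and>
     cobd2 G (past G) V \<rho>' \<mu>' \<omega>2 x y z = \<zero>\<^bsub>V\<^esub>)"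

lemma cocycles2_iff:
  "(\<omega>1, \<omega>2) \<in> cocycles2 K G V \<rho> \<mu> \<rho>' \<mu>' \<longleftrightarrow>
     \<omega>1 \<in> cochains2 K G V \<and> \<omega>2 \<in> cochains2 K G V \<and> cocycle \<omega>1 \<omega>2"
  by (simp add: cocycles2_def cocycle_def)

abbreviation twisted_dot :: "('g \<Rightarrow> 'g \<Rightarrow> 'v) \<Rightarrow> 'g \<times> 'v \<Rightarrow> 'g \<times> 'v \<Rightarrow> 'g \<times> 'v" where
  "twisted_dot \<equiv> twisted_product V (pdot G) \<rho> \<mu>"

abbreviation twisted_ast :: "('g \<Rightarrow> 'g \<Rightarrow> 'v) \<Rightarrow> 'g \<times> 'v \<Rightarrow> 'g \<times> 'v \<Rightarrow> 'g \<times> 'v" where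
  "twisted_ast \<equiv> twisted_product V (past G) \<rho>' \<mu>'"

text \<open>Once the action terms cancel, the defects no longer depend on the
  \<open>V\<close>-entries: their first component vanishes because \<open>G\<close> is compatible,
  and the second is minus the corresponding coboundary expression. This one equivalence serves both
  to show that extensions give cocycles and to build extensions from cocycles.\<close>

lemma twisted_compatible_iff_cocycle:
  assumes \<omega>: "\<omega>1 \<in> bilinear_maps K G G V" "\<omega>2 \<in> bilinear_maps K G G V"
  shows "compatible_products K (direct_sum G V) (twisted_dot \<omega>1) (twisted_ast \<omega>2) \<longleftrightarrow> cocycle \<omega>1 \<omega>2"
proof -
  interpret w: bilinear_map K G G V \<omega>1 by unfold_locales (rule assms)
  interpret w': bilinear_map K G G V \<omega>2 by unfold_locales (rule assms)
  interpret dd: twisted_pair K G V "pdot G" \<rho> \<mu> \<omega>1 "pdot G" \<rho> \<mu> \<omega>1 ..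
  interpret da: twisted_pair K G V "pdot G" \<rho> \<mu> \<omega>1 "past G" \<rho>' \<mu>' \<omega>2 ..
  interpret ad: twisted_pair K G V "past G" \<rho>' \<mu>' \<omega>2 "pdot G" \<rho> \<mu> \<omega>1 ..
  interpret aa: twisted_pair K G V "past G" \<rho>' \<mu>' \<omega>2 "past G" \<rho>' \<mu>' \<omega>2 ..
  have prep: "pre_lie_representation K G (pdot G) V \<rho> \<mu>" "pre_lie_representation K G (past G) V \<rho>' \<mu>'"
    using rep by (simp_all add: compat_representation_def)
  note bil = p.bilinear p'.bilinear r.bilinear m.bilinear r'.bilinear m'.bilinear
  note cl = cobd2_closed[OF p.bilinear r.bilinear m.bilinear] cobd2_closed[OF p'.bilinear r'.bilinear m'.bilinear]
  have Gd: "mixed_defect G (pdot G) (pdot G) x y z = \<zero>\<^bsub>G\<^esub>"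
    "mixed_defect G (past G) (past G) x y z = \<zero>\<^bsub>G\<^esub>"
    "mixed_defect G (pdot G) (past G) x y z \<oplus>\<^bsub>G\<^esub> mixed_defect G (past G) (pdot G) x y z = \<zero>\<^bsub>G\<^esub>"
    if "x \<in> carrier G" "y \<in> carrier G" "z \<in> carrier G" for x y z
    using compatible_G that by (simp_all add: compatible_products_def)
  have minus_self: "a \<ominus>\<^bsub>V\<^esub> a = \<zero>\<^bsub>V\<^esub>" and minus_zero: "a \<ominus>\<^bsub>V\<^esub> \<zero>\<^bsub>V\<^esub> = a" if "a \<in> carrier V" for a
    using that by (simp_all add: V.M.minus_eq V.M.r_neg)
  have dot: "mixed_defect (direct_sum G V) (twisted_dot \<omega>1) (twisted_dot \<omega>1) (x, u) (y, v) (z, w)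
      = (\<zero>\<^bsub>G\<^esub>, \<ominus>\<^bsub>V\<^esub> cobd2 G (pdot G) V \<rho> \<mu> \<omega>1 x y z)"
    and ast: "mixed_defect (direct_sum G V) (twisted_ast \<omega>2) (twisted_ast \<omega>2) (x, u) (y, v) (z, w)
      = (\<zero>\<^bsub>G\<^esub>, \<ominus>\<^bsub>V\<^esub> cobd2 G (past G) V \<rho>' \<mu>' \<omega>2 x y z)"
    if "x \<in> carrier G" "y \<in> carrier G" "z \<in> carrier G" "u \<in> carrier V" "v \<in> carrier V" "w \<in> carrier V"
    for x y z u v w
  proof -
    \<comment> \<open>\<open>representation_middle\<close> turns each middle term into the matching
      right term; these closure facts let the resulting difference of equal terms vanish.\<close>
    have Q: "right_action_defect V (pdot G) \<mu> \<mu> a b t \<in> carrier V"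
      "right_action_defect V (past G) \<mu>' \<mu>' a b t \<in> carrier V"
      if "a \<in> carrier G" "b \<in> carrier G" "t \<in> carrier V" for a b t
      using that by (simp_all add: right_action_defect_def)
    show "mixed_defect (direct_sum G V) (twisted_dot \<omega>1) (twisted_dot \<omega>1) (x, u) (y, v) (z, w)
        = (\<zero>\<^bsub>G\<^esub>, \<ominus>\<^bsub>V\<^esub> cobd2 G (pdot G) V \<rho> \<mu> \<omega>1 x y z)"
      using that \<omega> bil by (simp add: dd.mixed_defect_twisted Gd representation_left[OF prep(1)] representation_middle[OF prep(1)]
          cobd2_conv_associator cl Q minus_self minus_zero)
    show "mixed_defect (direct_sum G V) (twisted_ast \<omega>2) (twisted_ast \<omega>2) (x, u) (y, v) (z, w)
        = (\<zero>\<^bsub>G\<^esub>, \<ominus>\<^bsub>V\<^esub> cobd2 G (past G) V \<rho>' \<mu>' \<omega>2 x y z)"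
      using that \<omega> bil by (simp add: aa.mixed_defect_twisted Gd representation_left[OF prep(2)] representation_middle[OF prep(2)]
          cobd2_conv_associator cl Q minus_self minus_zero)
  qed
  have mixed: "mixed_defect (direct_sum G V) (twisted_dot \<omega>1) (twisted_ast \<omega>2) (x, u) (y, v) (z, w)
      \<oplus>\<^bsub>direct_sum G V\<^esub> mixed_defect (direct_sum G V) (twisted_ast \<omega>2) (twisted_dot \<omega>1) (x, u) (y, v) (z, w)
      = (\<zero>\<^bsub>G\<^esub>, \<ominus>\<^bsub>V\<^esub> (cobd2 G (past G) V \<rho>' \<mu>' \<omega>1 x y z \<oplus>\<^bsub>V\<^esub> cobd2 G (pdot G) V \<rho> \<mu> \<omega>2 x y z))"
    if "x \<in> carrier G" "y \<in> carrier G" "z \<in> carrier G" "u \<in> carrier V" "v \<in> carrier V" "w \<in> carrier V"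
    for x y z u v w
  proof -
    \<comment> \<open>Aligns the two defects by type of term, since the mixed axioms apply only to
      the sums.\<close>
    have rearrange: "(a \<oplus>\<^bsub>V\<^esub> b \<oplus>\<^bsub>V\<^esub> c \<ominus>\<^bsub>V\<^esub> d) \<oplus>\<^bsub>V\<^esub> (a' \<oplus>\<^bsub>V\<^esub> b' \<oplus>\<^bsub>V\<^esub> c' \<ominus>\<^bsub>V\<^esub> d')
        = (a \<oplus>\<^bsub>V\<^esub> a') \<oplus>\<^bsub>V\<^esub> (b \<oplus>\<^bsub>V\<^esub> b') \<oplus>\<^bsub>V\<^esub> (c \<oplus>\<^bsub>V\<^esub> c') \<ominus>\<^bsub>V\<^esub> (d \<oplus>\<^bsub>V\<^esub> d')"
      if "{a, b, c, d, a', b', c', d'} \<subseteq> carrier V" for a b c d a' b' c' d'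
      using that by (simp add: V.M.minus_eq V.M.minus_add V.M.a_ac)
    show ?thesis using that \<omega>
      apply (simp add: da.mixed_defect_twisted ad.mixed_defect_twisted Gd)
      apply (subst rearrange)
       apply (simp add: action_defs)
      apply (simp add: cobd2_conv_mixed_associator compat_representation_left compat_representation_middle
          cl minus_zero)
      done
  qed
  have "twisted_dot \<omega>1 \<in> bilinear_maps K (direct_sum G V) (direct_sum G V) (direct_sum G V)"
    "twisted_ast \<omega>2 \<in> bilinear_maps K (direct_sum G V) (direct_sum G V) (direct_sum G V)"
    using \<omega> by (auto intro!: twisted_product_bilinear bil G.module_axioms V.module_axioms)
  \<comment> \<open>To read the cocycle conditions off the defects, the \<open>V\<close>-entries
    need some value; zero is available.\<close>
  moreover have "\<zero>\<^bsub>V\<^esub> \<in> carrier V" by simp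
  ultimately show ?thesis using \<omega>
    unfolding compatible_products_def cocycle_def
    by (auto simp: direct_sum_vectorspace[OF vectorspace_G vectorspace_V] dot ast mixed cl)
qed

end

section \<open>Cohomologous cocycles\<close>

lemma (in module) module_hom_zero:
  "(\<lambda>x. \<zero>\<^bsub>M\<^esub>) \<in> module_hom R N M"
  by (simp add: module_hom_def)

lemma (in module) module_hom_neg:
  assumes "f \<in> module_hom R N M"
  shows "(\<lambda>x. \<ominus>\<^bsub>M\<^esub> f x) \<in> module_hom R N M"
  using assms by (auto simp: module_hom_def M.minus_add smult_r_minus Pi_iff)

lemma (in module) module_hom_sum:
  assumes "f \<in> module_hom R N M" "g \<in> module_hom R N M"
  shows "(\<lambda>x. f x \<oplus>\<^bsub>M\<^esub> g x) \<in> module_hom R N M"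
  using assms by (auto simp: module_hom_def M.a_ac smult_r_distr Pi_iff)

context compat_rep begin

lemma cobd1_eq:
  "x \<in> carrier G \<Longrightarrow> y \<in> carrier G
    \<Longrightarrow> cobd1 G \<pi> V r m f x y = r x (f y) \<oplus>\<^bsub>V\<^esub> m y (f x) \<ominus>\<^bsub>V\<^esub> f (\<pi> x y)"
  by (simp add: cobd1_def)

lemma cochains2_closed:
  "\<omega> \<in> cochains2 K G V \<Longrightarrow> x \<in> carrier G \<Longrightarrow> y \<in> carrier G \<Longrightarrow> \<omega> x y \<in> carrier V"
  by (auto simp: cochains2_def bilinear_maps_def module_hom_def)

lemma hom_closed: "f \<in> module_hom K G V \<Longrightarrow> x \<in> carrier G \<Longrightarrow> f x \<in> carrier V"
  using module_hom_closed by blast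

text \<open>Additive and pointwise form of being cohomologous, with an explicit linear map that need
  not be extensional; negation and addition of witnesses then need no restriction.\<close>

definition differ_by_coboundary ::
  "('g \<Rightarrow> 'v) \<Rightarrow> ('g \<Rightarrow> 'g \<Rightarrow> 'v) \<times> ('g \<Rightarrow> 'g \<Rightarrow> 'v) \<Rightarrow> ('g \<Rightarrow> 'g \<Rightarrow> 'v) \<times> ('g \<Rightarrow> 'g \<Rightarrow> 'v) \<Rightarrow> bool" where
  "differ_by_coboundary f \<omega> \<eta> \<longleftrightarrow> f \<in> module_hom K G V \<and> (\<forall>x\<in>carrier G. \<forall>y\<in>carrier G.
     fst \<omega> x y = fst \<eta> x y \<oplus>\<^bsub>V\<^esub> cobd1 G (pdot G) V \<rho> \<mu> f x y \<and>
     snd \<omega> x y = snd \<eta> x y \<oplus>\<^bsub>V\<^esub> cobd1 G (past G) V \<rho>' \<mu>' f x y)"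

text \<open>Both sides are restricted to the carrier in each argument, so equality of functions is
  equality on the carrier.\<close>

lemma cochain_diff_eq_cobd1_iff:
  assumes "\<omega> \<in> cochains2 K G V" "\<eta> \<in> cochains2 K G V" "f \<in> module_hom K G V"
    and "\<pi> \<in> bilinear_maps K G G G" "r \<in> bilinear_maps K G V V" "m \<in> bilinear_maps K G V V"
  shows "cochain_diff G V \<omega> \<eta> = cobd1 G \<pi> V r m f \<longleftrightarrow>
    (\<forall>x\<in>carrier G. \<forall>y\<in>carrier G. \<omega> x y = \<eta> x y \<oplus>\<^bsub>V\<^esub> cobd1 G \<pi> V r m f x y)"
proof -
  interpret q: bilinear_map K G G G \<pi> by unfold_locales (rule assms)
  interpret s: bilinear_map K G V V r by unfold_locales (rule assms)
  interpret n: bilinear_map K G V V m by unfold_locales (rule assms)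
  have "cochain_diff G V \<omega> \<eta> = cobd1 G \<pi> V r m f \<longleftrightarrow>
    (\<forall>x\<in>carrier G. \<forall>y\<in>carrier G. \<omega> x y \<ominus>\<^bsub>V\<^esub> \<eta> x y = cobd1 G \<pi> V r m f x y)"
    by (auto simp: cochain_diff_def cobd1_def fun_eq_iff restrict_def)
  then show ?thesis
    using assms by (simp add: cobd1_eq cochains2_closed hom_closed V.M.minus_eq_iff)
qed

text \<open>The coboundary evaluates \<open>f\<close> only on the carrier, which is closed under
  \<pi>. This lets an arbitrary linear witness be replaced by an extensional one.\<close>

lemma cobd1_restrict:
  assumes "\<pi> \<in> bilinear_maps K G G G"
  shows "cobd1 G \<pi> V r m (restrict f (carrier G)) = cobd1 G \<pi> V r m f"
proof -
  interpret q: bilinear_map K G G G \<pi> by unfold_locales (rule assms)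
  show ?thesis by (auto simp: cobd1_def intro!: restrict_ext)
qed

lemma cohomologous_iff:
  "(\<omega>, \<eta>) \<in> cohomologous K G V \<rho> \<mu> \<rho>' \<mu>' \<longleftrightarrow>
     \<omega> \<in> cocycles2 K G V \<rho> \<mu> \<rho>' \<mu>' \<and> \<eta> \<in> cocycles2 K G V \<rho> \<mu> \<rho>' \<mu>' \<and>
     (\<exists>f. differ_by_coboundary f \<omega> \<eta>)"
proof -
  obtain \<omega>1 \<omega>2 \<eta>1 \<eta>2 where [simp]: "\<omega> = (\<omega>1, \<omega>2)" "\<eta> = (\<eta>1, \<eta>2)" by fastforce
  note bil = p.bilinear p'.bilinear r.bilinear m.bilinear r'.bilinear m'.bilinear
  have "(cochain_diff G V \<omega>1 \<eta>1, cochain_diff G V \<omega>2 \<eta>2) \<in> coboundaries2 K G V \<rho> \<mu> \<rho>' \<mu>'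
      \<longleftrightarrow> (\<exists>f. differ_by_coboundary f \<omega> \<eta>)"
    if "\<omega> \<in> cocycles2 K G V \<rho> \<mu> \<rho>' \<mu>'" "\<eta> \<in> cocycles2 K G V \<rho> \<mu> \<rho>' \<mu>'"
  proof -
    have c: "\<omega>1 \<in> cochains2 K G V" "\<omega>2 \<in> cochains2 K G V" "\<eta>1 \<in> cochains2 K G V" "\<eta>2 \<in> cochains2 K G V"
      using that by (simp_all add: cocycles2_iff)
    have *: "differ_by_coboundary f \<omega> \<eta> \<longleftrightarrow> f \<in> module_hom K G V \<and>
        cochain_diff G V \<omega>1 \<eta>1 = cobd1 G (pdot G) V \<rho> \<mu> f \<and>
        cochain_diff G V \<omega>2 \<eta>2 = cobd1 G (past G) V \<rho>' \<mu>' f" for f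
      using c bil by (auto simp: differ_by_coboundary_def cochain_diff_eq_cobd1_iff)
    have "restrict f (carrier G) \<in> cochains1 K G V" if "f \<in> module_hom K G V" for f
      using that by (auto simp: cochains1_def module_hom_def)
    then show ?thesis
      unfolding * coboundaries2_def image_iff
      by (metis (no_types, lifting) Int_iff bil(1,2) cobd1_restrict cochains1_def prod.inject)
  qed
  then show ?thesis by (auto simp: cohomologous_def)
qed

lemma differ_by_coboundary_zero:
  assumes "\<omega> \<in> cocycles2 K G V \<rho> \<mu> \<rho>' \<mu>'"
  shows "differ_by_coboundary (\<lambda>x. \<zero>\<^bsub>V\<^esub>) \<omega> \<omega>"
  using assms unfolding differ_by_coboundary_def
  by (cases \<omega>) (auto simp: cobd1_eq cocycles2_iff cochains2_closed V.module_hom_zero V.M.minus_eq)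

lemma differ_by_coboundary_neg:
  assumes "differ_by_coboundary f \<omega> \<eta>" "\<eta> \<in> cocycles2 K G V \<rho> \<mu> \<rho>' \<mu>'"
  shows "differ_by_coboundary (\<lambda>x. \<ominus>\<^bsub>V\<^esub> f x) \<eta> \<omega>"
proof -
  have cancel: "b = b \<oplus>\<^bsub>V\<^esub> c \<oplus>\<^bsub>V\<^esub> \<ominus>\<^bsub>V\<^esub> c" if "b \<in> carrier V" "c \<in> carrier V" for b c
    using that by (simp add: V.M.a_assoc V.M.r_neg)
  have f: "f \<in> module_hom K G V" using assms by (simp add: differ_by_coboundary_def)
  have "cobd1 G (pdot G) V \<rho> \<mu> (\<lambda>x. \<ominus>\<^bsub>V\<^esub> f x) x y = \<ominus>\<^bsub>V\<^esub> cobd1 G (pdot G) V \<rho> \<mu> f x y"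
    "cobd1 G (past G) V \<rho>' \<mu>' (\<lambda>x. \<ominus>\<^bsub>V\<^esub> f x) x y = \<ominus>\<^bsub>V\<^esub> cobd1 G (past G) V \<rho>' \<mu>' f x y"
    "cobd1 G (pdot G) V \<rho> \<mu> f x y \<in> carrier V" "cobd1 G (past G) V \<rho>' \<mu>' f x y \<in> carrier V"
    if "x \<in> carrier G" "y \<in> carrier G" for x y
    using that hom_closed[OF f]
    by (simp_all add: cobd1_eq r.neg_right m.neg_right r'.neg_right m'.neg_right
        V.M.minus_eq V.M.minus_add V.M.a_ac)
  then show ?thesis using assms f unfolding differ_by_coboundary_def
    by (cases \<omega>; cases \<eta>) (auto simp: V.module_hom_neg cocycles2_iff cochains2_closed cancel)
qed

lemma differ_by_coboundary_sum:
  assumes "differ_by_coboundary f \<omega> \<eta>" "differ_by_coboundary g \<eta> \<theta>"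
    and "\<theta> \<in> cocycles2 K G V \<rho> \<mu> \<rho>' \<mu>'"
  shows "differ_by_coboundary (\<lambda>x. f x \<oplus>\<^bsub>V\<^esub> g x) \<omega> \<theta>"
proof -
  have f: "f \<in> module_hom K G V" and g: "g \<in> module_hom K G V"
    using assms by (simp_all add: differ_by_coboundary_def)
  show ?thesis using assms f g hom_closed[OF f] hom_closed[OF g]
    unfolding differ_by_coboundary_def
    by (cases \<omega>; cases \<eta>; cases \<theta>)
      (auto simp: V.module_hom_sum cobd1_eq cocycles2_iff cochains2_closed r.add_right m.add_right
        r'.add_right m'.add_right V.M.minus_eq V.M.minus_add V.M.a_ac)
qed

lemma equiv_cohomologous:
  "equiv (cocycles2 K G V \<rho> \<mu> \<rho>' \<mu>') (cohomologous K G V \<rho> \<mu> \<rho>' \<mu>')"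
proof (rule equivI)
  show "cohomologous K G V \<rho> \<mu> \<rho>' \<mu>' \<subseteq> cocycles2 K G V \<rho> \<mu> \<rho>' \<mu>' \<times> cocycles2 K G V \<rho> \<mu> \<rho>' \<mu>'"
    by (auto simp: cohomologous_def)
  show "refl_on (cocycles2 K G V \<rho> \<mu> \<rho>' \<mu>') (cohomologous K G V \<rho> \<mu> \<rho>' \<mu>')"
    using differ_by_coboundary_zero by (intro refl_onI) (auto simp only: cohomologous_iff)
  show "sym (cohomologous K G V \<rho> \<mu> \<rho>' \<mu>')"
  proof (rule symI)
    fix \<omega> \<eta> assume "(\<omega>, \<eta>) \<in> cohomologous K G V \<rho> \<mu> \<rho>' \<mu>'"
    then show "(\<eta>, \<omega>) \<in> cohomologous K G V \<rho> \<mu> \<rho>' \<mu>'"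
      unfolding cohomologous_iff using differ_by_coboundary_neg by blast
  qed
  show "trans (cohomologous K G V \<rho> \<mu> \<rho>' \<mu>')"
  proof (rule transI)
    fix \<omega> \<eta> \<theta>
    assume "(\<omega>, \<eta>) \<in> cohomologous K G V \<rho> \<mu> \<rho>' \<mu>'" "(\<eta>, \<theta>) \<in> cohomologous K G V \<rho> \<mu> \<rho>' \<mu>'"
    then show "(\<omega>, \<theta>) \<in> cohomologous K G V \<rho> \<mu> \<rho>' \<mu>'"
      unfolding cohomologous_iff using differ_by_coboundary_sum by blast
  qed
qed

end

section \<open>Extensions with a section\<close>

text \<open>Only the linear data; products enter in \<open>split_product\<close>, which is
  instantiated once for each product over the same chart.\<close>

locale split_extension =
  G: module K G + V: module K V + E: module K E +
  i: mod_hom K V E i + p: mod_hom K E G p + s: mod_hom K G E s for K G V E i p s +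
  assumes inj_i: "inj_on i (carrier V)"
    and image_i: "i ` carrier V = {e \<in> carrier E. p e = \<zero>\<^bsub>G\<^esub>}"
    and p_s [simp]: "x \<in> carrier G \<Longrightarrow> p (s x) = x"
begin

lemma p_i [simp]: "u \<in> carrier V \<Longrightarrow> p (i u) = \<zero>\<^bsub>G\<^esub>"
  using image_i by blast

lemma i_eq_iff: "u \<in> carrier V \<Longrightarrow> v \<in> carrier V \<Longrightarrow> i u = i v \<longleftrightarrow> u = v"
  using inj_i by (simp add: inj_on_eq_iff)

lemma i_from_image: "e \<in> carrier E \<Longrightarrow> p e = \<zero>\<^bsub>G\<^esub> \<Longrightarrow> i (inv_into (carrier V) i e) = e"
  using image_i by (intro f_inv_into_f) simp

lemma from_image_closed:
  "e \<in> carrier E \<Longrightarrow> p e = \<zero>\<^bsub>G\<^esub> \<Longrightarrow> inv_into (carrier V) i e \<in> carrier V"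
  using image_i by (intro inv_into_into) simp

definition chart where "chart = (\<lambda>(x, u). s x \<oplus>\<^bsub>E\<^esub> i u)"

lemma p_chart: "x \<in> carrier G \<Longrightarrow> u \<in> carrier V \<Longrightarrow> p (chart (x, u)) = x"
  by (simp add: chart_def)

lemma chart_hom: "chart \<in> module_hom K (direct_sum G V) E"
  by (auto simp: chart_def module_hom_def E.M.a_ac E.smult_r_distr)

lemma inj_chart: "inj_on chart (carrier G \<times> carrier V)"
proof (rule inj_onI; clarify)
  fix x u y v
  assume *: "x \<in> carrier G" "u \<in> carrier V" "y \<in> carrier G" "v \<in> carrier V" "chart (x, u) = chart (y, v)"
  then have "x = y" using p_chart by metis
  then show "x = y \<and> u = v" using * by (simp add: chart_def i_eq_iff)
qed

lemma image_chart: "chart ` (carrier G \<times> carrier V) = carrier E"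
proof
  show "chart ` (carrier G \<times> carrier V) \<subseteq> carrier E" by (auto simp: chart_def)
  show "carrier E \<subseteq> chart ` (carrier G \<times> carrier V)"
  proof
    fix e assume e: "e \<in> carrier E"
    \<comment> \<open>Removing the section part leaves a vector in the kernel of \<open>p\<close>,
      that is, in the image of \<open>i\<close>.\<close>
    let ?d = "e \<ominus>\<^bsub>E\<^esub> s (p e)"
    have d: "?d \<in> carrier E" "p ?d = \<zero>\<^bsub>G\<^esub>" using e by (simp_all add: G.M.minus_eq G.M.r_neg)
    have "chart (p e, inv_into (carrier V) i ?d) = s (p e) \<oplus>\<^bsub>E\<^esub> ?d"
      using d by (simp add: chart_def i_from_image)
    also have "\<dots> = e" using e by (simp add: E.M.minus_eq E.M.a_ac E.M.r_neg E.M.a_lcomm[of "s (p e)" e])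
    finally have "e = chart (p e, inv_into (carrier V) i ?d)" by simp
    moreover have "(p e, inv_into (carrier V) i ?d) \<in> carrier G \<times> carrier V"
      using e d by (simp add: from_image_closed)
    ultimately show "e \<in> chart ` (carrier G \<times> carrier V)" by (rule image_eqI)
  qed
qed

end

text \<open>One product \<tau> of the extension over one product \<pi> of the base. The actions and
  the cochain are parameters tied to \<tau> only on carriers, so that the given representation and
  the extensional cocycle can be inserted directly.\<close>

locale split_product =
  split_extension K G V E i p s + t: bilinear_map K E E E \<tau> + q: bilinear_map K G G G \<pi>
  for K G V E i p s \<tau> \<pi> +
  fixes r m \<omega>
  assumes p_prod: "a \<in> carrier E \<Longrightarrow> b \<in> carrier E \<Longrightarrow> p (\<tau> a b) = \<pi> (p a) (p b)"
    and i_prod: "u \<in> carrier V \<Longrightarrow> v \<in> carrier V \<Longrightarrow> \<tau> (i u) (i v) = \<zero>\<^bsub>E\<^esub>"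
    and r_eq: "x \<in> carrier G \<Longrightarrow> u \<in> carrier V \<Longrightarrow> r x u = inv_into (carrier V) i (\<tau> (s x) (i u))"
    and m_eq: "x \<in> carrier G \<Longrightarrow> u \<in> carrier V \<Longrightarrow> m x u = inv_into (carrier V) i (\<tau> (i u) (s x))"
    and \<omega>_eq: "x \<in> carrier G \<Longrightarrow> y \<in> carrier G
      \<Longrightarrow> \<omega> x y = inv_into (carrier V) i (\<tau> (s x) (s y) \<ominus>\<^bsub>E\<^esub> s (\<pi> x y))"
begin

lemma i_r: "x \<in> carrier G \<Longrightarrow> u \<in> carrier V \<Longrightarrow> i (r x u) = \<tau> (s x) (i u)"
  by (simp add: r_eq i_from_image p_prod)

lemma i_m: "x \<in> carrier G \<Longrightarrow> u \<in> carrier V \<Longrightarrow> i (m x u) = \<tau> (i u) (s x)"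
  by (simp add: m_eq i_from_image p_prod)

lemma i_\<omega>: "x \<in> carrier G \<Longrightarrow> y \<in> carrier G \<Longrightarrow> i (\<omega> x y) = \<tau> (s x) (s y) \<ominus>\<^bsub>E\<^esub> s (\<pi> x y)"
  by (simp add: \<omega>_eq i_from_image p_prod G.M.minus_eq G.M.r_neg)

lemma closed:
  "x \<in> carrier G \<Longrightarrow> u \<in> carrier V \<Longrightarrow> r x u \<in> carrier V"
  "x \<in> carrier G \<Longrightarrow> u \<in> carrier V \<Longrightarrow> m x u \<in> carrier V"
  "x \<in> carrier G \<Longrightarrow> y \<in> carrier G \<Longrightarrow> \<omega> x y \<in> carrier V"
  by (simp_all add: r_eq m_eq \<omega>_eq from_image_closed p_prod G.M.minus_eq G.M.r_neg)

text \<open>Under the injective map \<open>i\<close>, the cochain becomes the failure of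
  \<open>s\<close> to be multiplicative, which is visibly bilinear.\<close>

lemma \<omega>_bilinear: "\<omega> \<in> bilinear_maps K G G V"
proof (rule bilinear_mapsI)
  have eq: "u = v" if "i u = i v" "u \<in> carrier V" "v \<in> carrier V" for u v
    using that by (simp add: i_eq_iff)
  show "\<omega> (x \<oplus>\<^bsub>G\<^esub> x') y = \<omega> x y \<oplus>\<^bsub>V\<^esub> \<omega> x' y"
    if "x \<in> carrier G" "x' \<in> carrier G" "y \<in> carrier G" for x x' y
    by (rule eq) (use that in \<open>simp_all add: i_\<omega> closed t.add_left q.add_left
      E.M.minus_eq E.M.minus_add E.M.a_ac\<close>)
  show "\<omega> x (y \<oplus>\<^bsub>G\<^esub> y') = \<omega> x y \<oplus>\<^bsub>V\<^esub> \<omega> x y'"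
    if "x \<in> carrier G" "y \<in> carrier G" "y' \<in> carrier G" for x y y'
    by (rule eq) (use that in \<open>simp_all add: i_\<omega> closed t.add_right q.add_right
      E.M.minus_eq E.M.minus_add E.M.a_ac\<close>)
  show "\<omega> (c \<odot>\<^bsub>G\<^esub> x) y = c \<odot>\<^bsub>V\<^esub> \<omega> x y"
    if "c \<in> carrier K" "x \<in> carrier G" "y \<in> carrier G" for c x y
    by (rule eq) (use that in \<open>simp_all add: i_\<omega> closed t.smult_left q.smult_left
      E.M.minus_eq E.smult_r_distr E.smult_r_minus\<close>)
  show "\<omega> x (c \<odot>\<^bsub>G\<^esub> y) = c \<odot>\<^bsub>V\<^esub> \<omega> x y"
    if "c \<in> carrier K" "x \<in> carrier G" "y \<in> carrier G" for c x y
    by (rule eq) (use that in \<open>simp_all add: i_\<omega> closed t.smult_right q.smult_right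
      E.M.minus_eq E.smult_r_distr E.smult_r_minus\<close>)
qed (rule closed)

text \<open>Of the four terms of the product of s x + i u and s y + i v, the last vanishes because
  \<open>V\<close> is abelian, the mixed two are the actions, and the first differs from
  \<open>s (\<pi> x y)\<close> by the cochain.\<close>

lemma chart_product:
  assumes "a \<in> carrier G \<times> carrier V" "b \<in> carrier G \<times> carrier V"
  shows "chart (twisted_product V \<pi> r m \<omega> a b) = \<tau> (chart a) (chart b)"
proof -
  obtain x u y v where ab: "a = (x, u)" "b = (y, v)" by fastforce
  then have [simp]: "x \<in> carrier G" "u \<in> carrier V" "y \<in> carrier G" "v \<in> carrier V" using assms by simp_all
  have "chart (twisted_product V \<pi> r m \<omega> a b)
      = s (\<pi> x y) \<oplus>\<^bsub>E\<^esub> ((\<tau> (s x) (s y) \<ominus>\<^bsub>E\<^esub> s (\<pi> x y)) \<oplus>\<^bsub>E\<^esub> \<tau> (s x) (i v) \<oplus>\<^bsub>E\<^esub> \<tau> (i u) (s y))"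
    by (simp add: ab chart_def closed i_r i_m i_\<omega>)
  also have "\<dots> = \<tau> (s x) (s y) \<oplus>\<^bsub>E\<^esub> \<tau> (s x) (i v) \<oplus>\<^bsub>E\<^esub> \<tau> (i u) (s y)"
  proof -
    have "c \<oplus>\<^bsub>E\<^esub> ((d \<ominus>\<^bsub>E\<^esub> c) \<oplus>\<^bsub>E\<^esub> e \<oplus>\<^bsub>E\<^esub> f) = (c \<ominus>\<^bsub>E\<^esub> c) \<oplus>\<^bsub>E\<^esub> (d \<oplus>\<^bsub>E\<^esub> e \<oplus>\<^bsub>E\<^esub> f)"
      if "c \<in> carrier E" "d \<in> carrier E" "e \<in> carrier E" "f \<in> carrier E" for c d e f
      using that by (simp add: E.M.minus_eq E.M.a_ac)
    then show ?thesis by (simp add: E.M.minus_eq E.M.r_neg)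
  qed
  also have "\<dots> = \<tau> (chart a) (chart b)"
    by (simp add: ab chart_def t.add_left t.add_right i_prod E.M.a_ac)
  finally show ?thesis .
qed

end

section \<open>Cocycles of extensions, and isomorphisms as shears\<close>

context compat_rep begin

abbreviation extensions :: "('k, 'g, 'v, 'e) extn set" where
  "extensions \<equiv> extensions_inducing K G V \<rho> \<mu> \<rho>' \<mu>'"

lemma extension_modules:
  assumes "(E, i, p) \<in> extensions"
  shows "compatible_products K E (pdot E) (past E)" "vectorspace K E"
  using assms by (simp_all add: extensions_inducing_def abelian_extension_def
      compatible_pre_lie_algebra_iff compatible_products_def)

lemma extension_has_section:
  assumes "(E, i, p) \<in> extensions"
  shows "\<exists>s. linear_section K G E p s"
proof -
  have p: "p \<in> module_hom K E G" "p ` carrier E = carrier G"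
    using assms by (simp_all add: extensions_inducing_def abelian_extension_def compat_pre_lie_hom_def)
  interpret linear_map K E G p
    using p extension_modules[OF assms] vectorspace_G
    by (simp add: linear_map_def mod_hom_def mod_hom_axioms_def vectorspace_module)
  show ?thesis using surjective_has_section[OF p(2)] by (auto simp: linear_section_def)
qed

text \<open>The inducing property holds for every section, in particular for the given
  \<open>s\<close>; hence both products are twisted by the fixed representation and the components
  of the cocycle of \<open>s\<close>.\<close>

lemma extension_split:
  assumes ext: "(E, i, p) \<in> extensions" and s: "linear_section K G E p s"
  shows "split_extension K G V E i p s"
    and "split_product K G V E i p s (pdot E) (pdot G) \<rho> \<mu> (fst (extension_cocycle G V (E, i, p) s))"
    and "split_product K G V E i p s (past E) (past G) \<rho>' \<mu>' (snd (extension_cocycle G V (E, i, p) s))"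
proof -
  have mE: "module K E" using extension_modules[OF ext] by (simp add: vectorspace_module)
  have hom: "i \<in> compat_pre_lie_hom K V E" "p \<in> compat_pre_lie_hom K E G" "s \<in> module_hom K G E"
    using ext s by (simp_all add: extensions_inducing_def abelian_extension_def linear_section_def)
  show split: "split_extension K G V E i p s"
    using ext s hom mE G.module_axioms V.module_axioms
    by (simp add: split_extension_def split_extension_axioms_def mod_hom_def mod_hom_axioms_def
        extensions_inducing_def abelian_extension_def compat_pre_lie_hom_def linear_section_def)
  interpret split_extension K G V E i p s by (rule split)
  have bil: "bilinear_map K E E E (pdot E)" "bilinear_map K E E E (past E)"
    using extension_modules[OF ext] mE
    by (simp_all add: compatible_products_def bilinear_map_def bilinear_map_axioms_def)
  \<comment> \<open>\<open>i\<close> is multiplicative and products in \<open>V\<close> are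
    zero.\<close>
  have i0: "i u \<bullet>\<^bsub>E\<^esub> i v = \<zero>\<^bsub>E\<^esub>" "i u \<star>\<^bsub>E\<^esub> i v = \<zero>\<^bsub>E\<^esub>" if "u \<in> carrier V" "v \<in> carrier V" for u v
    using V hom(1) that i.f0_is_0
    by (simp_all add: abelian_compatible_pre_lie_algebra_def compat_pre_lie_hom_def)
       (metis i.f0_is_0)+
  have ind: "\<rho> x u = from_image V i (s x \<bullet>\<^bsub>E\<^esub> i u)" "\<mu> x u = from_image V i (i u \<bullet>\<^bsub>E\<^esub> s x)"
    "\<rho>' x u = from_image V i (s x \<star>\<^bsub>E\<^esub> i u)" "\<mu>' x u = from_image V i (i u \<star>\<^bsub>E\<^esub> s x)"
    if "x \<in> carrier G" "u \<in> carrier V" for x u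
    using ext s that by (auto simp: extensions_inducing_def induces_representation_def)
  show "split_product K G V E i p s (pdot E) (pdot G) \<rho> \<mu> (fst (extension_cocycle G V (E, i, p) s))"
    using split bil p.bilinear_map_axioms hom i0 ind
    by (simp add: split_product_def split_product_axioms_def compat_pre_lie_hom_def extension_cocycle_def)
  show "split_product K G V E i p s (past E) (past G) \<rho>' \<mu>' (snd (extension_cocycle G V (E, i, p) s))"
    using split bil p'.bilinear_map_axioms hom i0 ind
    by (simp add: split_product_def split_product_axioms_def compat_pre_lie_hom_def extension_cocycle_def)
qed

text \<open>The cocycle identities are not computed in \<open>E\<close>: the chart pulls its
  products back to twisted products, these inherit compatibility, and
  \<open>twisted_compatible_iff_cocycle\<close> does the rest.\<close>

lemma extension_cocycle_in_cocycles2: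
  assumes ext: "(E, i, p) \<in> extensions" and s: "linear_section K G E p s"
  shows "extension_cocycle G V (E, i, p) s \<in> cocycles2 K G V \<rho> \<mu> \<rho>' \<mu>'"
proof -
  obtain \<theta> \<theta>' where c: "extension_cocycle G V (E, i, p) s = (\<theta>, \<theta>')" by fastforce
  interpret d: split_product K G V E i p s "pdot E" "pdot G" \<rho> \<mu> \<theta>
    using extension_split(2)[OF ext s] by (simp add: c)
  interpret a: split_product K G V E i p s "past E" "past G" \<rho>' \<mu>' \<theta>'
    using extension_split(3)[OF ext s] by (simp add: c)
  have "compatible_products K (direct_sum G V) (twisted_dot \<theta>) (twisted_ast \<theta>')"
    by (rule compatible_products_pullback[OF extension_modules(1)[OF ext] _ d.chart_hom])
      (auto simp: direct_sum_vectorspace vectorspace_G vectorspace_V d.inj_chart d.closed a.closed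
        d.chart_product a.chart_product simp del: twisted_product_simp,
       auto simp: d.closed a.closed)
  then have "cocycle \<theta> \<theta>'"
    using twisted_compatible_iff_cocycle d.\<omega>_bilinear a.\<omega>_bilinear by blast
  moreover have "\<theta> \<in> carrier G \<rightarrow>\<^sub>E extensional (carrier G)" "\<theta>' \<in> carrier G \<rightarrow>\<^sub>E extensional (carrier G)"
    using c by (auto simp: extension_cocycle_def)
  ultimately show ?thesis
    using d.\<omega>_bilinear a.\<omega>_bilinear by (simp add: c cocycles2_iff cochains2_def)
qed

lemma extension_iso_imp_differ_by_coboundary:
  assumes ext1: "(E1, i1, p1) \<in> extensions" and s1: "linear_section K G E1 p1 s1"
    and ext2: "(E2, i2, p2) \<in> extensions" and s2: "linear_section K G E2 p2 s2"
    and \<zeta>: "\<zeta> \<in> compat_pre_lie_hom K E1 E2" "\<And>u. u \<in> carrier V \<Longrightarrow> \<zeta> (i1 u) = i2 u"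
      "\<And>e. e \<in> carrier E1 \<Longrightarrow> p2 (\<zeta> e) = p1 e"
  shows "\<exists>f. differ_by_coboundary f (extension_cocycle G V (E1, i1, p1) s1) (extension_cocycle G V (E2, i2, p2) s2)"
proof -
  obtain \<theta>1 \<theta>1' where c1: "extension_cocycle G V (E1, i1, p1) s1 = (\<theta>1, \<theta>1')" by fastforce
  obtain \<theta>2 \<theta>2' where c2: "extension_cocycle G V (E2, i2, p2) s2 = (\<theta>2, \<theta>2')" by fastforce
  interpret E1: split_extension K G V E1 i1 p1 s1 by (rule extension_split(1)[OF ext1 s1])
  interpret E2: split_extension K G V E2 i2 p2 s2 by (rule extension_split(1)[OF ext2 s2])
  interpret z: mod_hom K E1 E2 \<zeta>
    using \<zeta>(1) by unfold_locales (simp add: compat_pre_lie_hom_def)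
  let ?d = "\<lambda>x. \<zeta> (s1 x) \<ominus>\<^bsub>E2\<^esub> s2 x"
  \<comment> \<open>Since \<zeta> lies over the identity of \<open>G\<close>, both \<zeta> o
    \<open>s1\<close> and \<open>s2\<close> are sections of \<open>p2\<close>; their difference
    takes values in the image of \<open>i2\<close>.\<close>
  define f where "f x = from_image V i2 (?d x)" for x
  have d: "?d x \<in> carrier E2" "p2 (?d x) = \<zero>\<^bsub>G\<^esub>" if "x \<in> carrier G" for x
    using that \<zeta>(3) by (simp_all add: G.M.minus_eq G.M.r_neg)
  have f_closed [simp]: "f x \<in> carrier V" and i_f: "i2 (f x) = ?d x" if "x \<in> carrier G" for x
    using d[OF that] by (simp_all add: f_def E2.from_image_closed E2.i_from_image)
  have eq: "u = v" if "i2 u = i2 v" "u \<in> carrier V" "v \<in> carrier V" for u v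
    using that by (simp add: E2.i_eq_iff)
  have zs: "\<zeta> (s1 x) = E2.chart (x, f x)" if "x \<in> carrier G" for x
  proof -
    have "b \<oplus>\<^bsub>E2\<^esub> (a \<ominus>\<^bsub>E2\<^esub> b) = a" if "a \<in> carrier E2" "b \<in> carrier E2" for a b
      using that by (metis E2.E.M.minus_eq_iff E2.E.M.minus_closed)
    then show ?thesis using that by (simp add: E2.chart_def i_f)
  qed
  have f: "f \<in> module_hom K G V"
    unfolding module_hom_def
    by (auto intro!: eq simp: i_f E2.E.M.minus_eq E2.E.M.minus_add E2.E.M.a_ac
        E2.E.smult_r_distr E2.E.smult_r_minus)
  \<comment> \<open>Stated for one arbitrary product, then applied to each of the two. The product
    of the chart points (x, f x) and (y, f y) contributes the action terms, and subtracting the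
    point over \<pi> x y contributes the last term of the coboundary.\<close>
  have key: "\<omega>1 x y = \<omega>2 x y \<oplus>\<^bsub>V\<^esub> cobd1 G \<pi> V r m f x y"
    if "split_product K G V E1 i1 p1 s1 \<tau>1 \<pi> r m \<omega>1" "split_product K G V E2 i2 p2 s2 \<tau>2 \<pi> r m \<omega>2"
      and z: "\<And>a b. a \<in> carrier E1 \<Longrightarrow> b \<in> carrier E1 \<Longrightarrow> \<zeta> (\<tau>1 a b) = \<tau>2 (\<zeta> a) (\<zeta> b)"
      and x: "x \<in> carrier G" "y \<in> carrier G" for \<tau>1 \<tau>2 \<pi> r m \<omega>1 \<omega>2 x y
  proof -
    interpret P1: split_product K G V E1 i1 p1 s1 \<tau>1 \<pi> r m \<omega>1 by (rule that(1))
    interpret P2: split_product K G V E2 i2 p2 s2 \<tau>2 \<pi> r m \<omega>2 by (rule that(2))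
    have "i2 (\<omega>1 x y) = \<zeta> (i1 (\<omega>1 x y))" using x by (simp add: \<zeta>(2) P1.closed)
    also have "\<dots> = \<tau>2 (E2.chart (x, f x)) (E2.chart (y, f y)) \<ominus>\<^bsub>E2\<^esub> E2.chart (\<pi> x y, f (\<pi> x y))"
      using x by (simp add: P1.i_\<omega> z zs)
    also have "\<dots> = E2.chart (\<pi> x y, \<omega>2 x y \<oplus>\<^bsub>V\<^esub> r x (f y) \<oplus>\<^bsub>V\<^esub> m y (f x)) \<ominus>\<^bsub>E2\<^esub> E2.chart (\<pi> x y, f (\<pi> x y))"
      using x by (simp flip: P2.chart_product)
    also have "\<dots> = i2 (\<omega>2 x y \<oplus>\<^bsub>V\<^esub> cobd1 G \<pi> V r m f x y)"
    proof -
      have "(c \<oplus>\<^bsub>E2\<^esub> a) \<ominus>\<^bsub>E2\<^esub> (c \<oplus>\<^bsub>E2\<^esub> b) = a \<ominus>\<^bsub>E2\<^esub> b"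
        if "a \<in> carrier E2" "b \<in> carrier E2" "c \<in> carrier E2" for a b c
      proof -
        have "(c \<oplus>\<^bsub>E2\<^esub> a) \<ominus>\<^bsub>E2\<^esub> (c \<oplus>\<^bsub>E2\<^esub> b) = (c \<ominus>\<^bsub>E2\<^esub> c) \<oplus>\<^bsub>E2\<^esub> (a \<ominus>\<^bsub>E2\<^esub> b)"
          using that by (simp add: E2.E.M.minus_eq E2.E.M.minus_add E2.E.M.a_ac)
        then show ?thesis using that by (simp add: E2.E.M.minus_eq E2.E.M.r_neg)
      qed
      then have "E2.chart (\<pi> x y, u) \<ominus>\<^bsub>E2\<^esub> E2.chart (\<pi> x y, v) = i2 (u \<ominus>\<^bsub>V\<^esub> v)"
        if "u \<in> carrier V" "v \<in> carrier V" for u v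
        using that x by (simp add: E2.chart_def)
      then show ?thesis using x
        by (simp add: P2.closed cobd1_eq V.M.minus_eq E2.E.M.minus_eq V.M.a_assoc E2.E.M.a_assoc)
    qed
    finally show ?thesis
      by (rule eq) (use x in \<open>simp_all add: P1.closed P2.closed cobd1_eq\<close>)
  qed
  have z: "\<zeta> (a \<bullet>\<^bsub>E1\<^esub> b) = \<zeta> a \<bullet>\<^bsub>E2\<^esub> \<zeta> b" "\<zeta> (a \<star>\<^bsub>E1\<^esub> b) = \<zeta> a \<star>\<^bsub>E2\<^esub> \<zeta> b"
    if "a \<in> carrier E1" "b \<in> carrier E1" for a b
    using \<zeta>(1) that by (simp_all add: compat_pre_lie_hom_def)
  have "differ_by_coboundary f (\<theta>1, \<theta>1') (\<theta>2, \<theta>2')"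
    unfolding differ_by_coboundary_def
    using f extension_split(2,3)[OF ext1 s1] extension_split(2,3)[OF ext2 s2] z
    by (auto simp: c1 c2 intro!: key)
  then show ?thesis by (auto simp: c1 c2)
qed

lemma differ_by_coboundary_imp_extension_iso:
  assumes ext1: "(E1, i1, p1) \<in> extensions" and s1: "linear_section K G E1 p1 s1"
    and ext2: "(E2, i2, p2) \<in> extensions" and s2: "linear_section K G E2 p2 s2"
    and f: "differ_by_coboundary f (extension_cocycle G V (E1, i1, p1) s1) (extension_cocycle G V (E2, i2, p2) s2)"
  shows "\<exists>\<zeta>. \<zeta> \<in> compat_pre_lie_hom K E1 E2 \<and> bij_betw \<zeta> (carrier E1) (carrier E2) \<and>
             (\<forall>u\<in>carrier V. \<zeta> (i1 u) = i2 u) \<and> (\<forall>e\<in>carrier E1. p2 (\<zeta> e) = p1 e)"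
proof -
  obtain \<theta>1 \<theta>1' where c1: "extension_cocycle G V (E1, i1, p1) s1 = (\<theta>1, \<theta>1')" by fastforce
  obtain \<theta>2 \<theta>2' where c2: "extension_cocycle G V (E2, i2, p2) s2 = (\<theta>2, \<theta>2')" by fastforce
  interpret E1: split_extension K G V E1 i1 p1 s1 by (rule extension_split(1)[OF ext1 s1])
  interpret E2: split_extension K G V E2 i2 p2 s2 by (rule extension_split(1)[OF ext2 s2])
  interpret D1: split_product K G V E1 i1 p1 s1 "pdot E1" "pdot G" \<rho> \<mu> \<theta>1
    using extension_split(2)[OF ext1 s1] by (simp add: c1)
  interpret A1: split_product K G V E1 i1 p1 s1 "past E1" "past G" \<rho>' \<mu>' \<theta>1'
    using extension_split(3)[OF ext1 s1] by (simp add: c1)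
  interpret D2: split_product K G V E2 i2 p2 s2 "pdot E2" "pdot G" \<rho> \<mu> \<theta>2
    using extension_split(2)[OF ext2 s2] by (simp add: c2)
  interpret A2: split_product K G V E2 i2 p2 s2 "past E2" "past G" \<rho>' \<mu>' \<theta>2'
    using extension_split(3)[OF ext2 s2] by (simp add: c2)
  have fhom: "f \<in> module_hom K G V" using f by (simp add: differ_by_coboundary_def)
  interpret f: mod_hom K G V f by unfold_locales (rule fhom)
  define \<Delta> where "\<Delta> = carrier G \<times> carrier V"
  \<comment> \<open>The shear by \<open>f\<close> in coordinates; \<zeta> is obtained by conjugating
    it with the two charts.\<close>
  define T where "T = (\<lambda>(x, u). (x, u \<oplus>\<^bsub>V\<^esub> f x))"
  have T: "T a \<in> \<Delta>" if "a \<in> \<Delta>" for a using that by (auto simp: T_def \<Delta>_def)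
  have "bij_betw T \<Delta> \<Delta>"
  proof (rule bij_betw_byWitness[where f' = "\<lambda>(x, u). (x, u \<ominus>\<^bsub>V\<^esub> f x)"])
    show "\<forall>a\<in>\<Delta>. (\<lambda>(x, u). (x, u \<ominus>\<^bsub>V\<^esub> f x)) (T a) = a"
      by (auto simp: T_def \<Delta>_def V.M.minus_eq V.M.a_assoc V.M.r_neg)
    show "\<forall>a\<in>\<Delta>. T ((\<lambda>(x, u). (x, u \<ominus>\<^bsub>V\<^esub> f x)) a) = a"
      by (auto simp: T_def \<Delta>_def V.M.minus_eq V.M.a_assoc V.M.l_neg)
  qed (auto simp: T_def \<Delta>_def)
  moreover have b1: "bij_betw E1.chart \<Delta> (carrier E1)" and b2: "bij_betw E2.chart \<Delta> (carrier E2)"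
    by (simp_all add: bij_betw_def \<Delta>_def E1.inj_chart E1.image_chart E2.inj_chart E2.image_chart)
  moreover define \<zeta> where "\<zeta> = E2.chart \<circ> T \<circ> inv_into \<Delta> E1.chart"
  ultimately have bij: "bij_betw \<zeta> (carrier E1) (carrier E2)"
    by (auto intro: bij_betw_trans bij_betw_inv_into)
  have \<zeta>: "\<zeta> (E1.chart a) = E2.chart (T a)" if "a \<in> \<Delta>" for a
    using that b1 by (simp add: \<zeta>_def bij_betw_def)
  have chart1: "\<exists>a\<in>\<Delta>. e = E1.chart a" if "e \<in> carrier E1" for e
    using that b1 by (auto simp: bij_betw_def)
  interpret ch1: mod_hom K "direct_sum G V" E1 "E1.chart"
    by (intro mod_hom.intro mod_hom_axioms.intro direct_sum_is_module G.module_axioms V.module_axioms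
        E1.E.module_axioms E1.chart_hom)
  interpret ch2: mod_hom K "direct_sum G V" E2 "E2.chart"
    by (intro mod_hom.intro mod_hom_axioms.intro direct_sum_is_module G.module_axioms V.module_axioms
        E2.E.module_axioms E2.chart_hom)
  have "\<zeta> \<in> module_hom K E1 E2"
    unfolding module_hom_def
  proof (intro CollectI conjI allI impI; (elim conjE)?)
    show "\<zeta> \<in> carrier E1 \<rightarrow> carrier E2" using bij by (auto simp: bij_betw_def)
    show "\<zeta> (e \<oplus>\<^bsub>E1\<^esub> e') = \<zeta> e \<oplus>\<^bsub>E2\<^esub> \<zeta> e'" if ee: "e \<in> carrier E1" "e' \<in> carrier E1" for e e'
    proof -
      obtain a b where ab: "a \<in> \<Delta>" "b \<in> \<Delta>" "e = E1.chart a" "e' = E1.chart b"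
        using chart1 ee by metis
      have "T (a \<oplus>\<^bsub>direct_sum G V\<^esub> b) = T a \<oplus>\<^bsub>direct_sum G V\<^esub> T b" "a \<oplus>\<^bsub>direct_sum G V\<^esub> b \<in> \<Delta>"
        using ab by (auto simp: T_def \<Delta>_def V.M.a_ac)
      then show ?thesis using ab T
        by (simp add: \<zeta> \<Delta>_def flip: ch1.f_add ch2.f_add)
    qed
    show "\<zeta> (c \<odot>\<^bsub>E1\<^esub> e) = c \<odot>\<^bsub>E2\<^esub> \<zeta> e" if ce: "c \<in> carrier K" "e \<in> carrier E1" for c e
    proof -
      obtain a where ab: "a \<in> \<Delta>" "e = E1.chart a"
        using chart1 ce by metis
      have "T (c \<odot>\<^bsub>direct_sum G V\<^esub> a) = c \<odot>\<^bsub>direct_sum G V\<^esub> T a" "c \<odot>\<^bsub>direct_sum G V\<^esub> a \<in> \<Delta>"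
        using ab ce by (auto simp: T_def \<Delta>_def V.smult_r_distr)
      then show ?thesis using ab T ce
        by (simp add: \<zeta> \<Delta>_def flip: ch1.f_smult ch2.f_smult)
    qed
  qed
  moreover have "\<zeta> (e \<bullet>\<^bsub>E1\<^esub> e') = \<zeta> e \<bullet>\<^bsub>E2\<^esub> \<zeta> e' \<and> \<zeta> (e \<star>\<^bsub>E1\<^esub> e') = \<zeta> e \<star>\<^bsub>E2\<^esub> \<zeta> e'"
    if ee: "e \<in> carrier E1" "e' \<in> carrier E1" for e e'
  proof -
    obtain a b where ab: "a \<in> \<Delta>" "b \<in> \<Delta>" "e = E1.chart a" "e' = E1.chart b"
      using chart1 ee by metis
    obtain x u y v where xy: "a = (x, u)" "b = (y, v)" by fastforce
    have [simp]: "x \<in> carrier G" "u \<in> carrier V" "y \<in> carrier G" "v \<in> carrier V"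
      using ab by (simp_all add: xy \<Delta>_def)
    have in\<Delta>: "twisted_dot \<theta>1 a b \<in> \<Delta>" "twisted_ast \<theta>1' a b \<in> \<Delta>"
      by (simp_all add: xy \<Delta>_def D1.closed A1.closed)
    \<comment> \<open>The term -f(\<pi> x y) of the coboundary cancels against the shear of the
      product, while its other two terms are absorbed into the sheared arguments. This is why the
      shear is multiplicative.\<close>
    have shift: "(t \<oplus>\<^bsub>V\<^esub> (b' \<oplus>\<^bsub>V\<^esub> c' \<ominus>\<^bsub>V\<^esub> d)) \<oplus>\<^bsub>V\<^esub> b \<oplus>\<^bsub>V\<^esub> c \<oplus>\<^bsub>V\<^esub> d = t \<oplus>\<^bsub>V\<^esub> (b \<oplus>\<^bsub>V\<^esub> b') \<oplus>\<^bsub>V\<^esub> (c \<oplus>\<^bsub>V\<^esub> c')"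
      if "t \<in> carrier V" "b \<in> carrier V" "c \<in> carrier V" "b' \<in> carrier V" "c' \<in> carrier V" "d \<in> carrier V"
      for t b c b' c' d
    proof -
      have "(t \<oplus>\<^bsub>V\<^esub> (b' \<oplus>\<^bsub>V\<^esub> c' \<ominus>\<^bsub>V\<^esub> d)) \<oplus>\<^bsub>V\<^esub> b \<oplus>\<^bsub>V\<^esub> c \<oplus>\<^bsub>V\<^esub> d
          = (t \<oplus>\<^bsub>V\<^esub> (b \<oplus>\<^bsub>V\<^esub> b') \<oplus>\<^bsub>V\<^esub> (c \<oplus>\<^bsub>V\<^esub> c')) \<oplus>\<^bsub>V\<^esub> (d \<ominus>\<^bsub>V\<^esub> d)"
        using that by (simp add: V.M.minus_eq V.M.a_ac)
      then show ?thesis using that by (simp add: V.M.minus_eq V.M.r_neg)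
    qed
    have "\<theta>1 x y = \<theta>2 x y \<oplus>\<^bsub>V\<^esub> (\<rho> x (f y) \<oplus>\<^bsub>V\<^esub> \<mu> y (f x) \<ominus>\<^bsub>V\<^esub> f (x \<bullet>\<^bsub>G\<^esub> y))"
      "\<theta>1' x y = \<theta>2' x y \<oplus>\<^bsub>V\<^esub> (\<rho>' x (f y) \<oplus>\<^bsub>V\<^esub> \<mu>' y (f x) \<ominus>\<^bsub>V\<^esub> f (x \<star>\<^bsub>G\<^esub> y))"
      using f by (simp_all add: differ_by_coboundary_def c1 c2 cobd1_eq)
    then have "T (twisted_dot \<theta>1 a b) = twisted_dot \<theta>2 (T a) (T b)"
      "T (twisted_ast \<theta>1' a b) = twisted_ast \<theta>2' (T a) (T b)"
      by (simp_all add: xy T_def shift r.add_right m.add_right r'.add_right m'.add_right D2.closed A2.closed)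
    then show ?thesis
      using ab in\<Delta> T[OF ab(1)] T[OF ab(2)] D1.chart_product[of a b] A1.chart_product[of a b]
        D2.chart_product[of "T a" "T b"] A2.chart_product[of "T a" "T b"] \<zeta>[of a] \<zeta>[of b]
        \<zeta>[OF in\<Delta>(1)] \<zeta>[OF in\<Delta>(2)]
      by (simp add: \<Delta>_def)
  qed
  ultimately have "\<zeta> \<in> compat_pre_lie_hom K E1 E2" by (simp add: compat_pre_lie_hom_def)
  \<comment> \<open>On the fibre over zero the shear is the identity, because \<open>f\<close> sends
    zero to zero.\<close>
  moreover have "\<zeta> (i1 u) = i2 u" if "u \<in> carrier V" for u
    using that \<zeta>[of "(\<zero>\<^bsub>G\<^esub>, u)"] by (simp add: \<Delta>_def T_def E1.chart_def E2.chart_def)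
  moreover have "p2 (\<zeta> e) = p1 e" if e: "e \<in> carrier E1" for e
  proof -
    obtain a where "a \<in> \<Delta>" "e = E1.chart a" using chart1[OF e] by blast
    then show ?thesis by (auto simp: \<zeta> \<Delta>_def T_def E1.p_chart E2.p_chart)
  qed
  ultimately show ?thesis using bij by blast
qed

text \<open>The sections are arbitrary on both sides, so applying this to one extension with two
  sections also yields independence of the section.\<close>

lemma extension_iso_iff_cohomologous:
  assumes "(E1, i1, p1) \<in> extensions" "linear_section K G E1 p1 s1"
    and "(E2, i2, p2) \<in> extensions" "linear_section K G E2 p2 s2"
  shows "((E1, i1, p1), (E2, i2, p2)) \<in> extension_iso K G V \<rho> \<mu> \<rho>' \<mu>' \<longleftrightarrow>
    (extension_cocycle G V (E1, i1, p1) s1, extension_cocycle G V (E2, i2, p2) s2)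
      \<in> cohomologous K G V \<rho> \<mu> \<rho>' \<mu>'"
proof
  assume "((E1, i1, p1), (E2, i2, p2)) \<in> extension_iso K G V \<rho> \<mu> \<rho>' \<mu>'"
  then obtain \<zeta> where "\<zeta> \<in> compat_pre_lie_hom K E1 E2" "\<forall>u\<in>carrier V. \<zeta> (i1 u) = i2 u"
    "\<forall>e\<in>carrier E1. p2 (\<zeta> e) = p1 e"
    by (auto simp: extension_iso_def)
  then show "(extension_cocycle G V (E1, i1, p1) s1, extension_cocycle G V (E2, i2, p2) s2)
      \<in> cohomologous K G V \<rho> \<mu> \<rho>' \<mu>'"
    unfolding cohomologous_iff
    using extension_iso_imp_differ_by_coboundary[OF assms, of \<zeta>] extension_cocycle_in_cocycles2 assms
    by blast
next
  assume "(extension_cocycle G V (E1, i1, p1) s1, extension_cocycle G V (E2, i2, p2) s2)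
      \<in> cohomologous K G V \<rho> \<mu> \<rho>' \<mu>'"
  then show "((E1, i1, p1), (E2, i2, p2)) \<in> extension_iso K G V \<rho> \<mu> \<rho>' \<mu>'"
    unfolding cohomologous_iff extension_iso_def
    using differ_by_coboundary_imp_extension_iso[OF assms] assms by blast
qed

end

section \<open>Extensions from cocycles and the classification\<close>

context compat_rep begin

text \<open>The twisted model on pairs, copied into \<open>'e\<close> along \<open>j\<close>. The
  section x |-> (x, 0) recovers the given cocycle exactly, not merely up to a coboundary.\<close>

lemma cocycle_has_extension:
  fixes j :: "'g \<times> 'v \<Rightarrow> 'e"
  assumes c: "(\<omega>1, \<omega>2) \<in> cocycles2 K G V \<rho> \<mu> \<rho>' \<mu>'"
    and j: "inj_on j (carrier G \<times> carrier V)"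
  shows "\<exists>(E :: ('k, 'e) compat_pre_lie) i p s. (E, i, p) \<in> extensions \<and>
    linear_section K G E p s \<and> extension_cocycle G V (E, i, p) s = (\<omega>1, \<omega>2)"
proof -
  let ?D = "direct_sum G V"
  define k where "k = inv_into (carrier ?D) j"
  have k_j [simp]: "k (j a) = a" if "a \<in> carrier ?D" for a
    using j that by (simp add: k_def)
  define E :: "('k, 'e) compat_pre_lie" where
    "E = \<lparr>carrier = j ` carrier ?D, mult = undefined, one = undefined, zero = j \<zero>\<^bsub>?D\<^esub>,
      add = (\<lambda>a b. j (k a \<oplus>\<^bsub>?D\<^esub> k b)), smult = (\<lambda>c a. j (c \<odot>\<^bsub>?D\<^esub> k a)),
      pdot = (\<lambda>a b. j (twisted_dot \<omega>1 (k a) (k b))), past = (\<lambda>a b. j (twisted_ast \<omega>2 (k a) (k b)))\<rparr>"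
  have \<omega>: "\<omega>1 \<in> bilinear_maps K G G V" "\<omega>2 \<in> bilinear_maps K G G V"
    "\<omega>1 \<in> cochains2 K G V" "\<omega>2 \<in> cochains2 K G V" "cocycle \<omega>1 \<omega>2"
    using c by (simp_all add: cocycles2_iff cochains2_def)
  interpret w: bilinear_map K G G V \<omega>1 by unfold_locales (rule \<omega>)
  interpret w': bilinear_map K G G V \<omega>2 by unfold_locales (rule \<omega>)
  have D: "compatible_products K ?D (twisted_dot \<omega>1) (twisted_ast \<omega>2)" "vectorspace K ?D"
    using \<omega> by (simp_all add: twisted_compatible_iff_cocycle direct_sum_vectorspace vectorspace_G vectorspace_V)
  interpret D: vectorspace K ?D by (rule D(2))
  have tw: "twisted_dot \<omega>1 a b \<in> carrier ?D" "twisted_ast \<omega>2 a b \<in> carrier ?D"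
    if "a \<in> carrier ?D" "b \<in> carrier ?D" for a b
    using that by auto
  have carrier_E: "carrier E = j ` carrier ?D" and zero_E: "\<zero>\<^bsub>E\<^esub> = j \<zero>\<^bsub>?D\<^esub>"
    by (simp_all add: E_def)
  have E_smult: "c \<odot>\<^bsub>E\<^esub> j a = j (c \<odot>\<^bsub>?D\<^esub> a)" if "a \<in> carrier ?D" for a c
    using that by (simp add: E_def del: direct_sum_simps)
  have E_mult: "j a \<oplus>\<^bsub>E\<^esub> j b = j (a \<oplus>\<^bsub>?D\<^esub> b)"
    "j a \<bullet>\<^bsub>E\<^esub> j b = j (twisted_dot \<omega>1 a b)" "j a \<star>\<^bsub>E\<^esub> j b = j (twisted_ast \<omega>2 a b)"
    if "a \<in> carrier ?D" "b \<in> carrier ?D" for a b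
    using that by (simp_all add: E_def del: direct_sum_simps twisted_product_simp)
  note E_ops = E_smult E_mult
  have inj_k: "inj_on k (carrier E)" by (rule inj_onI) (auto simp: carrier_E simp del: direct_sum_simps)
  \<comment> \<open>The copy inherits its structure through \<open>k\<close>, which inverts
    \<open>j\<close> on the carrier and is therefore injective there.\<close>
  have vsE: "vectorspace K E"
  proof (rule vectorspace_pullback[OF D(2), where \<phi> = k])
    show "\<exists>y\<in>carrier E. k y = \<ominus>\<^bsub>?D\<^esub> k x" if "x \<in> carrier E" for x
    proof -
      have "\<ominus>\<^bsub>?D\<^esub> k x \<in> carrier ?D"
        using that by (intro D.module.M.a_inv_closed) (auto simp: carrier_E simp del: direct_sum_simps)
      then show ?thesis by (intro bexI[of _ "j (\<ominus>\<^bsub>?D\<^esub> k x)"])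
          (auto simp: carrier_E simp del: direct_sum_simps)
    qed
  qed (use inj_k D.module.M.zero_closed D.module.M.a_closed D.module.smult_closed in
      \<open>auto simp: carrier_E zero_E E_ops simp del: direct_sum_simps\<close>)
  interpret EA: abelian_group E using vsE by (rule vectorspace_abelian_group)
  have "k \<in> module_hom K E ?D"
    using D.module.M.a_closed D.module.smult_closed
    by (auto simp: module_hom_def carrier_E E_ops simp del: direct_sum_simps)
  then have "compatible_products K E (pdot E) (past E)"
    using D(1) vsE inj_k tw
    by (intro compatible_products_pullback[where \<phi> = k and E = ?D])
      (auto simp: carrier_E E_ops simp del: direct_sum_simps twisted_product_simp)
  then have E: "compatible_pre_lie_algebra K E" by (simp add: compatible_pre_lie_algebra_iff)
  define i where "i u = j (\<zero>\<^bsub>G\<^esub>, u)" for u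
  define p where "p e = fst (k e)" for e
  define s where "s x = j (x, \<zero>\<^bsub>V\<^esub>)" for x
  have p_j [simp]: "p (j (x, u)) = x" if "x \<in> carrier G" "u \<in> carrier V" for x u
    using that by (simp add: p_def)
  have in_E: "j (x, u) \<in> carrier E" if "x \<in> carrier G" "u \<in> carrier V" for x u
    using that by (simp add: carrier_E)
  have V0: "u \<bullet>\<^bsub>V\<^esub> v = \<zero>\<^bsub>V\<^esub>" "u \<star>\<^bsub>V\<^esub> v = \<zero>\<^bsub>V\<^esub>" if "u \<in> carrier V" "v \<in> carrier V" for u v
    using V that by (simp_all add: abelian_compatible_pre_lie_algebra_def)
  have i: "i \<in> compat_pre_lie_hom K V E"
    by (auto simp: compat_pre_lie_hom_def module_hom_def i_def in_E E_ops V0)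
  have p: "p \<in> compat_pre_lie_hom K E G"
    by (auto simp: compat_pre_lie_hom_def module_hom_def carrier_E E_ops)
  have inj_i: "inj_on i (carrier V)"
    using j by (auto simp: i_def inj_on_def)
  have from_i: "from_image V i (j (\<zero>\<^bsub>G\<^esub>, u)) = u" if "u \<in> carrier V" for u
    using inv_into_f_f[OF inj_i that] by (simp add: i_def)
  have "abelian_extension K G V E i p"
    unfolding abelian_extension_def
  proof (intro conjI V E i p inj_i)
    show "i ` carrier V = {e \<in> carrier E. p e = \<zero>\<^bsub>G\<^esub>}"
      by (auto simp: i_def carrier_E image_iff)
    have "x \<in> p ` carrier E" if "x \<in> carrier G" for x
      by (rule image_eqI[of _ _ "j (x, \<zero>\<^bsub>V\<^esub>)"]) (use that in \<open>auto simp: in_E\<close>)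
    then show "p ` carrier E = carrier G" by (auto simp: carrier_E)
  qed
  moreover have "induces_representation K G V E i p \<rho> \<mu> \<rho>' \<mu>'"
    unfolding induces_representation_def
  proof (intro allI impI ballI)
    fix s' x u assume s': "linear_section K G E p s'" and xu: "x \<in> carrier G" "u \<in> carrier V"
    then have "s' x \<in> carrier E" "p (s' x) = x" by (auto simp: linear_section_def module_hom_def)
    \<comment> \<open>An arbitrary section differs from the standard one by some \<open>w\<close> in
      \<open>V\<close>. Multiplying (x, w) by (0, u) kills both the cochain term and the action on
      \<open>w\<close>, so the actions found do not depend on \<open>w\<close>.\<close>
    then obtain w where "w \<in> carrier V" "s' x = j (x, w)" by (auto simp: carrier_E)
    then show "\<rho> x u = from_image V i (s' x \<bullet>\<^bsub>E\<^esub> i u) \<and> \<mu> x u = from_image V i (i u \<bullet>\<^bsub>E\<^esub> s' x) \<and>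
        \<rho>' x u = from_image V i (s' x \<star>\<^bsub>E\<^esub> i u) \<and> \<mu>' x u = from_image V i (i u \<star>\<^bsub>E\<^esub> s' x)"
      using xu by (simp add: i_def E_ops from_i)
  qed
  ultimately have "(E, i, p) \<in> extensions" by (simp add: extensions_inducing_def)
  moreover have "linear_section K G E p s"
    by (auto simp: linear_section_def module_hom_def s_def in_E E_ops)
  moreover have "extension_cocycle G V (E, i, p) s = (\<omega>1, \<omega>2)"
  proof -
    have "s x \<bullet>\<^bsub>E\<^esub> s y \<ominus>\<^bsub>E\<^esub> s (x \<bullet>\<^bsub>G\<^esub> y) = j (\<zero>\<^bsub>G\<^esub>, \<omega>1 x y)"
      "s x \<star>\<^bsub>E\<^esub> s y \<ominus>\<^bsub>E\<^esub> s (x \<star>\<^bsub>G\<^esub> y) = j (\<zero>\<^bsub>G\<^esub>, \<omega>2 x y)"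
      if "x \<in> carrier G" "y \<in> carrier G" for x y
      using that by (simp_all add: EA.minus_eq_iff s_def in_E E_ops)
    \<comment> \<open>Cochains are extensional, so equality on the carrier suffices for equality
      with the restricted functions in \<open>extension_cocycle\<close>.\<close>
    moreover have "\<omega> = (\<lambda>x\<in>carrier G. \<lambda>y\<in>carrier G. \<omega> x y)" if "\<omega> \<in> cochains2 K G V" for \<omega>
      using that by (auto simp: cochains2_def fun_eq_iff restrict_def PiE_def extensional_def Pi_iff)
    ultimately show ?thesis using \<omega>
      by (simp add: extension_cocycle_def from_i cong: restrict_cong)
  qed
  ultimately show ?thesis by blast
qed

end

text \<open>Since \<open>R\<close> is the pullback of \<open>S\<close> along \<open>f\<close>, the
  \<open>R\<close>-class of \<open>a\<close> is determined by the \<open>S\<close>-class of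
  \<open>f a\<close>, which gives injectivity; hitting every \<open>S\<close>-class gives
  surjectivity.\<close>

lemma bij_betw_quotients:
  assumes S: "equiv B S" and f: "\<And>a. a \<in> A \<Longrightarrow> f a \<in> B"
    and R: "\<And>a a'. (a, a') \<in> R \<longleftrightarrow> a \<in> A \<and> a' \<in> A \<and> (f a, f a') \<in> S"
    and surj: "\<And>b. b \<in> B \<Longrightarrow> \<exists>a\<in>A. (f a, b) \<in> S"
  shows "\<exists>\<Phi>. bij_betw \<Phi> (A // R) (B // S) \<and> (\<forall>a\<in>A. \<Phi> (R `` {a}) = S `` {f a})"
proof (intro exI conjI)
  \<comment> \<open>Saturating the image under \<open>S\<close> avoids choosing representatives of
    classes.\<close>
  define \<Phi> where "\<Phi> X = S `` (f ` X)" for X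
  have refl: "(f a, f a) \<in> S" if "a \<in> A" for a
    using S f that by (meson equivE refl_onD)
  have \<Phi>: "\<Phi> (R `` {a}) = S `` {f a}" if a: "a \<in> A" for a
  proof -
    have "\<Phi> (R `` {a}) = (\<Union>a'\<in>R `` {a}. S `` {f a'})" by (auto simp: \<Phi>_def)
    also have "\<dots> = (\<Union>a'\<in>R `` {a}. S `` {f a})"
      using equiv_class_eq[OF S] R by (intro SUP_cong) auto
    also have "\<dots> = S `` {f a}" using a refl R by auto
    finally show ?thesis .
  qed
  then show "\<forall>a\<in>A. \<Phi> (R `` {a}) = S `` {f a}" by blast
  show "bij_betw \<Phi> (A // R) (B // S)"
    unfolding bij_betw_def
  proof
    show "inj_on \<Phi> (A // R)"
    proof (rule inj_onI)
      fix X Y assume XY: "X \<in> A // R" "Y \<in> A // R" "\<Phi> X = \<Phi> Y"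
      then obtain a b where ab: "a \<in> A" "b \<in> A" "X = R `` {a}" "Y = R `` {b}"
        by (auto elim!: quotientE)
      then have eq: "S `` {f a} = S `` {f b}" using XY \<Phi> by simp
      then have "(f a, f c) \<in> S \<longleftrightarrow> (f b, f c) \<in> S" for c by blast
      then show "X = Y" using ab R by auto
    qed
    show "\<Phi> ` (A // R) = B // S"
    proof
      show "\<Phi> ` (A // R) \<subseteq> B // S" using \<Phi> f by (auto elim!: quotientE intro!: quotientI)
      show "B // S \<subseteq> \<Phi> ` (A // R)"
      proof
        fix Y assume "Y \<in> B // S"
        then obtain b where b: "b \<in> B" "Y = S `` {b}" by (auto elim: quotientE)
        then obtain a where a: "a \<in> A" "(f a, b) \<in> S" using surj by blast
        then have "Y = \<Phi> (R `` {a})" using b \<Phi> equiv_class_eq[OF S] by auto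
        then show "Y \<in> \<Phi> ` (A // R)" using a by (auto intro: quotientI)
      qed
    qed
  qed
qed

theorem theorem4p13:
  fixes K :: "('k, 'r) ring_scheme"
    and G :: "('k, 'g) compat_pre_lie"
    and V :: "('k, 'v) compat_pre_lie"
    and \<rho> \<mu> \<rho>' \<mu>' :: "'g \<Rightarrow> 'v \<Rightarrow> 'v"
  assumes "field K"
    and "compatible_pre_lie_algebra K G"
    and "abelian_compatible_pre_lie_algebra K V"
    and "compat_representation K G V \<rho> \<mu> \<rho>' \<mu>'"
    and "\<exists>j :: 'g \<times> 'v \<Rightarrow> 'e. inj_on j (carrier G \<times> carrier V)"
  shows "\<exists>\<Phi>.
    bij_betw \<Phi>
      ((extensions_inducing K G V \<rho> \<mu> \<rho>' \<mu>' :: ('k, 'g, 'v, 'e) extn set)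
         // extension_iso K G V \<rho> \<mu> \<rho>' \<mu>')
      (cohomology2 K G V \<rho> \<mu> \<rho>' \<mu>') \<and>
    (\<forall>(E, i, p) \<in> extensions_inducing K G V \<rho> \<mu> \<rho>' \<mu>'.
       (\<exists>s. linear_section K G E p s) \<and>
       (\<forall>s. linear_section K G E p s \<longrightarrow>
          extension_cocycle G V (E, i, p) s \<in> cocycles2 K G V \<rho> \<mu> \<rho>' \<mu>' \<and>
          \<Phi> (extension_iso K G V \<rho> \<mu> \<rho>' \<mu>' `` {(E, i, p)})
            = cohomologous K G V \<rho> \<mu> \<rho>' \<mu>' `` {extension_cocycle G V (E, i, p) s}))"
proof -
  interpret compat_rep K G V \<rho> \<mu> \<rho>' \<mu>' by (rule compat_rep.intro) (rule assms)+
  let ?A = "extensions :: ('k, 'g, 'v, 'e) extn set"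
  let ?R = "extension_iso K G V \<rho> \<mu> \<rho>' \<mu>' :: ('k, 'g, 'v, 'e) extn rel"
  let ?B = "cocycles2 K G V \<rho> \<mu> \<rho>' \<mu>'" and ?S = "cohomologous K G V \<rho> \<mu> \<rho>' \<mu>'"
  \<comment> \<open>An arbitrary choice of section makes the cocycle a function of the extension;
    \<open>any_section\<close> shows that the choice does not affect the class.\<close>
  define sec where "sec X = (case X of (E, i, p) \<Rightarrow> SOME s. linear_section K G E p s)"
    for X :: "('k, 'g, 'v, 'e) extn"
  have sec: "linear_section K G E p (sec (E, i, p))" if "(E, i, p) \<in> ?A" for E i p
    using extension_has_section[OF that] by (simp add: sec_def someI_ex)
  define f where "f X = extension_cocycle G V X (sec X)" for X
  have f: "f X \<in> ?B" if "X \<in> ?A" for X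
    using that by (cases X) (simp add: f_def sec extension_cocycle_in_cocycles2)
  have R: "(X, Y) \<in> ?R \<longleftrightarrow> X \<in> ?A \<and> Y \<in> ?A \<and> (f X, f Y) \<in> ?S" for X Y
  proof (cases "X \<in> ?A \<and> Y \<in> ?A")
    case True
    then show ?thesis
      by (cases X; cases Y) (simp add: f_def sec extension_iso_iff_cohomologous)
  next
    case False
    then show ?thesis by (auto simp: extension_iso_def)
  qed
  have any_section: "(extension_cocycle G V (E, i, p) s, f (E, i, p)) \<in> ?S"
    if "(E, i, p) \<in> ?A" "linear_section K G E p s" for E i p s
  proof -
    \<comment> \<open>Reflexivity of cohomology makes the extension isomorphic to itself via
      \<open>R\<close>; reading this back with \<open>s\<close> and the chosen section compares
      their cocycles.\<close>
    have "(f (E, i, p), f (E, i, p)) \<in> ?S"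
      using f[OF that(1)] equiv_cohomologous by (meson equivE refl_onD)
    then have "((E, i, p), (E, i, p)) \<in> ?R" using that R by blast
    then show ?thesis
      using extension_iso_iff_cohomologous[OF that that(1) sec[OF that(1)]] by (simp add: f_def)
  qed
  have "\<exists>X\<in>?A. (f X, b) \<in> ?S" if b: "b \<in> ?B" for b
  proof -
    \<comment> \<open>The injection provides room in \<open>'e\<close> for an extension realizing
      \<open>b\<close>.\<close>
    obtain j :: "'g \<times> 'v \<Rightarrow> 'e" where "inj_on j (carrier G \<times> carrier V)" using assms(5) by blast
    then obtain E i p s where X: "(E, i, p) \<in> ?A" "linear_section K G E p s"
      "extension_cocycle G V (E, i, p) s = b"
      using cocycle_has_extension[of "fst b" "snd b" j] b by auto
    then have "(f (E, i, p), b) \<in> ?S"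
      using any_section[OF X(1,2)] equiv_cohomologous by (metis equivE symD)
    then show ?thesis using X(1) by blast
  qed
  then obtain \<Phi> where \<Phi>: "bij_betw \<Phi> (?A // ?R) (?B // ?S)" "\<And>X. X \<in> ?A \<Longrightarrow> \<Phi> (?R `` {X}) = ?S `` {f X}"
    using bij_betw_quotients[OF equiv_cohomologous, of ?A f ?R] f R by blast
  have "\<Phi> (?R `` {(E, i, p)}) = ?S `` {extension_cocycle G V (E, i, p) s}"
    if "(E, i, p) \<in> ?A" "linear_section K G E p s" for E i p s
    using \<Phi>(2)[OF that(1)] equiv_class_eq[OF equiv_cohomologous any_section[OF that]] by simp
  then show ?thesis
    using \<Phi>(1) extension_has_section extension_cocycle_in_cocycles2
    unfolding cohomology2_def by (intro exI[of _ \<Phi>]) auto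
qed

end
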